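(* Let $d\ge1$ be an integer, let $p\ge 1$ be real, and let $|\cdot|$ be a norm on $\mathbb{R}^d$. (a) Let $\mu$ and $\nu$ be two probability measures on $([0,1]^d,\mathcal{B}or([0,1]^d))$ such that $\mu\big((0,1]^d\big)=\nu\big((0,1]^d\big)=1$. Then $$\mathcal{W}_p^p(\mu,\nu)\le \mathfrak{d}_d^{\,p}\,\frac{2^p+1}{2}\sum_{\ell=1}^{+\infty}2^{-p\ell}\sum_{F\in\mathcal{P}_\ell}|\mu(F)-\nu(F)|,\qquad (\ast)$$ and, for every integer $\ell_0\ge 1$, $$\mathcal{W}_p^p(\mu,\nu)\le \mathfrak{d}_d^{\,p}\left(\frac{2^p+1}{2}\sum_{\ell=1}^{\ell_0}2^{-p\ell}\sum_{F\in\mathcal{P}_\ell}|\mu(F)-\nu(F)|+2^{-p\ell_0}\right).$$ (b) Let $\mu$ and $\nu$ be two arbitrary probability measures on $([0,1]^d,\mathcal{B}or([0,1]^d))$. Then inequality $(\ast)$ still holds with $\mathcal{P}_\ell$ replaced by $\widetilde{\mathcal{P}}_\ell$ for every $\ell$, i.e. $$\mathcal{W}_p^p(\mu,\nu)\le \mathfrak{d}_d^{\,p}\,\frac{2^p+1}{2}\sum_{\ell=1}^{+\infty}2^{-p\ell}\sum_{F\in\widetilde{\mathcal{P}}_\ell}|\mu(F)-\nu(F)|.$$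
   Context: $\mathcal{W}_p$ denotes the $p$-Wasserstein distance associated with the norm $|\cdot|$: $\mathcal{W}_p(\mu,\nu)=\inf\{(\mathbb{E}|X-Y|^p)^{1/p}: X\sim\mu,\ Y\sim\nu\}$, and $\mathcal{W}_p^p=(\mathcal{W}_p)^p$. $\mathfrak{d}_d=\sup_{x,y\in(0,1]^d}|y-x|$ is the diameter of $(0,1]^d$ for the norm $|\cdot|$. For an integer $\ell\ge0$, with $\mathbf{1}=(1,\dots,1)$, $$\mathcal{P}_\ell=\Big\{a+(-2^{-(\ell+1)},2^{-(\ell+1)}]^d:\ a=\tfrac{2\mathbf{k}+\mathbf{1}}{2^{\ell+1}},\ \mathbf{k}\in\{0,\dots,2^\ell-1\}^d\Big\},$$ i.e. the partition of $(0,1]^d$ into the $2^{d\ell}$ dyadic semi-open cubes $\prod_{i=1}^d\big(\tfrac{k_i}{2^\ell},\tfrac{k_i+1}{2^\ell}\big]$. $\widetilde{\mathcal{P}}_\ell$ is the partition of $[0,1]^d$ obtained from $\mathcal{P}_\ell$ by replacing, for every multi-index $\mathbf{k}=(k_1,\dots,k_d)\in\{0,\dots,2^\ell-1\}^d$ having at least one coordinate $k_i=0$, the corresponding semi-open cube by $$\Big\{u\in[0,1]^d:\ \text{for each } i,\ \tfrac{k_i}{2^\ell}<u^i\le\tfrac{k_i+1}{2^\ell}\text{ if }k_i\ge1,\ \text{and } 0\le u^i\le\tfrac1{2^\ell}\text{ if }k_i=0\Big\};$$ the other cubes are unchanged. *)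

theory Defs
  imports "HOL-Probability.Probability"
begin

definition is_norm :: "('a::real_vector \<Rightarrow> real) \<Rightarrow> bool" where
  "is_norm N \<longleftrightarrow>
     (\<forall>x. 0 \<le> N x) \<and> (\<forall>x. N x = 0 \<longleftrightarrow> x = 0) \<and>
     (\<forall>c x. N (c *\<^sub>R x) = \<bar>c\<bar> * N x) \<and> (\<forall>x y. N (x + y) \<le> N x + N y)"

definition norm_diameter :: "('a::real_vector \<Rightarrow> real) \<Rightarrow> 'a set \<Rightarrow> real" where
  "norm_diameter N S = (SUP (x, y) \<in> S \<times> S. N (y - x))"

definition unit_cube :: "(real ^ 'd) set" where
  "unit_cube = {u. \<forall>i. 0 \<le> u $ i \<and> u $ i \<le> 1}"

definition semiopen_unit_cube :: "(real ^ 'd) set" where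
  "semiopen_unit_cube = {u. \<forall>i. 0 < u $ i \<and> u $ i \<le> 1}"

(* The infimum runs over random variables X, Y on a common probability space.
   A definition cannot quantify over the type of that space, so it is fixed to be the type
   of pairs; wasserstein_le below shows that a space of any other type gives nothing
   smaller.  Pairs (X, Y) of infinite cost are left out because their Bochner integral
   would be 0; this does not change the infimum as long as some pair has finite cost,
   which always holds for probability measures on the unit cube. *)
definition wasserstein ::
    "real \<Rightarrow> ('a::real_vector \<Rightarrow> real) \<Rightarrow> 'a measure \<Rightarrow> 'a measure \<Rightarrow> real" where
  "wasserstein p N \<mu> \<nu> =
     Inf {(\<integral>\<omega>. N (X \<omega> - Y \<omega>) powr p \<partial>M) powr (1 / p) | (M :: ('a \<times> 'a) measure) X Y.
            prob_space M \<and>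
            X \<in> M \<rightarrow>\<^sub>M \<mu> \<and> distr M \<mu> X = \<mu> \<and>
            Y \<in> M \<rightarrow>\<^sub>M \<nu> \<and> distr M \<nu> Y = \<nu> \<and>
            integrable M (\<lambda>\<omega>. N (X \<omega> - Y \<omega>) powr p)}"

lemma wasserstein_le:
  fixes M :: "'c measure"
  assumes "prob_space M"
    and X [measurable]: "X \<in> M \<rightarrow>\<^sub>M \<mu>" "distr M \<mu> X = \<mu>"
    and Y [measurable]: "Y \<in> M \<rightarrow>\<^sub>M \<nu>" "distr M \<nu> Y = \<nu>"
    and int: "integrable M (\<lambda>\<omega>. N (X \<omega> - Y \<omega>) powr p)"
    and N [measurable]: "(\<lambda>z. N (fst z - snd z)) \<in> borel_measurable (\<mu> \<Otimes>\<^sub>M \<nu>)"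
  shows "wasserstein p N \<mu> \<nu> \<le> (\<integral>\<omega>. N (X \<omega> - Y \<omega>) powr p \<partial>M) powr (1 / p)"
proof -
  interpret prob_space M by fact
  define L where "L = distr M (\<mu> \<Otimes>\<^sub>M \<nu>) (\<lambda>\<omega>. (X \<omega>, Y \<omega>))"
  have XY: "(\<lambda>\<omega>. (X \<omega>, Y \<omega>)) \<in> M \<rightarrow>\<^sub>M \<mu> \<Otimes>\<^sub>M \<nu>" by simp
  have L: "prob_space L" unfolding L_def by (rule prob_space_distr[OF XY])
  have m: "(\<lambda>z. N (fst z - snd z) powr p) \<in> borel_measurable (\<mu> \<Otimes>\<^sub>M \<nu>)" by measurable
  have i: "integrable L (\<lambda>z. N (fst z - snd z) powr p)"
    unfolding L_def using int by (simp add: integrable_distr_eq[OF XY m])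
  have e: "(\<integral>z. N (fst z - snd z) powr p \<partial>L) = (\<integral>\<omega>. N (X \<omega> - Y \<omega>) powr p \<partial>M)"
    unfolding L_def by (simp add: integral_distr[OF XY m])
  have f: "fst \<in> L \<rightarrow>\<^sub>M \<mu>" "snd \<in> L \<rightarrow>\<^sub>M \<nu>"
    by (simp_all add: L_def)
  have d: "distr L \<mu> fst = \<mu>" "distr L \<nu> snd = \<nu>"
    using X Y by (simp_all add: L_def distr_distr[OF _ XY] comp_def)
  show ?thesis
    unfolding wasserstein_def
  proof (rule cInf_lower)
    show "(\<integral>\<omega>. N (X \<omega> - Y \<omega>) powr p \<partial>M) powr (1 / p) \<in>
      {(\<integral>\<omega>. N (X \<omega> - Y \<omega>) powr p \<partial>M) powr (1 / p) | (M :: ('a \<times> 'a) measure) X Y.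
            prob_space M \<and>
            X \<in> M \<rightarrow>\<^sub>M \<mu> \<and> distr M \<mu> X = \<mu> \<and>
            Y \<in> M \<rightarrow>\<^sub>M \<nu> \<and> distr M \<nu> Y = \<nu> \<and>
            integrable M (\<lambda>\<omega>. N (X \<omega> - Y \<omega>) powr p)}"
      unfolding mem_Collect_eq
      by (intro exI[of _ L] exI[of _ fst] exI[of _ snd]) (simp add: L f d i e)
  qed (auto intro!: bdd_belowI[of _ 0])
qed

definition dyadic_cube :: "nat \<Rightarrow> ('d \<Rightarrow> nat) \<Rightarrow> (real ^ 'd) set" where
  "dyadic_cube l k =
     {u. \<forall>i. real (k i) / 2 ^ l < u $ i \<and> u $ i \<le> (real (k i) + 1) / 2 ^ l}"

definition dyadic_partition :: "nat \<Rightarrow> (real ^ 'd) set set" where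
  "dyadic_partition l = {dyadic_cube l k | k. \<forall>i. k i < 2 ^ l}"

(* Agrees with dyadic_cube l k when no coordinate of k is 0. *)
definition dyadic_cube' :: "nat \<Rightarrow> ('d \<Rightarrow> nat) \<Rightarrow> (real ^ 'd) set" where
  "dyadic_cube' l k =
     {u. \<forall>i. (if k i = 0 then 0 \<le> u $ i else real (k i) / 2 ^ l < u $ i) \<and>
             u $ i \<le> (real (k i) + 1) / 2 ^ l}"

definition dyadic_partition' :: "nat \<Rightarrow> (real ^ 'd) set set" where
  "dyadic_partition' l = {dyadic_cube' l k | k. \<forall>i. k i < 2 ^ l}"

end

theory Submission
  imports Defs
begin

text \<open>
  A coupling of \<open>\<mu>\<close> and \<open>\<nu>\<close> is built greedily from the finest level \<open>L\<close> upwards: inside every cell of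
  the current level as much as possible of the mass not yet matched is matched.  Then for every level
  \<open>l \<le> L\<close> the two coordinates share a cell of level \<open>l\<close> with probability at least
  \<open>\<Sum>F. min (\<mu> F) (\<nu> F) = 1 - \<Delta>\<^sub>l / 2\<close>, where \<open>\<Delta>\<^sub>l = \<Sum>F. \<bar>\<mu> F - \<nu> F\<bar>\<close>.  Two points sharing a cell of level \<open>l\<close>
  are at distance at most \<open>D 2\<^sup>-\<^sup>l\<close>, \<open>D\<close> being the diameter, and an Abel summation over the levels gives the bound
  \<open>D\<^sup>p ((2\<^sup>p - 1) / 2 \<cdot> \<Sum>l=1..L. 2\<^sup>-\<^sup>p\<^sup>l \<Delta>\<^sub>l + 2\<^sup>-\<^sup>p\<^sup>L)\<close>, whose constant is even smaller than the one claimed.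
\<close>

section \<open>Couplings of finite distributions\<close>

text \<open>The order of the levels matters: points sharing a fine cell share every coarser one, so
  mass matched early counts at all later levels, while matching in a coarse cell first could use up
  mass that a fine cell needs. Greediness at one level does no harm at the next because the matched
  mass lies in diagonal blocks: in each cell it takes the same amount from \<open>\<mu>\<close> as
  from \<open>\<nu>\<close>, and min (s + t) (s' + t) = min s s' + t. The discrete coupling lives on
  the labels of level L; below that level the coordinates are independent given their labels, so one
  coupling controls finitely many levels and leaves the term 2^(-pL). The series bound comes from
  letting L grow in the inequality, without any limit of couplings. The factor 2^p - 1 is
  (2^(-p(l-1)) - 2^(-pl)) / 2^(-pl), and 1/2 comes from min u v = (u + v - |u - v|) / 2. Everything
  is done for the modified partition, whose cells cover the closed cube; in (a) the faces u_i = 0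
  are null, so both partitions give the same sums.\<close>

lemma partial_coupling_extend:
  fixes a b :: "'k \<Rightarrow> real" and \<pi> :: "'k \<Rightarrow> 'k \<Rightarrow> real"
  assumes K: "finite K" and J: "finite J" "g ` K \<subseteq> J"
    and nonneg: "\<And>x y. 0 \<le> \<pi> x y"
    and row: "\<And>x. x \<in> K \<Longrightarrow> (\<Sum>y\<in>K. \<pi> x y) \<le> a x"
    and col: "\<And>y. y \<in> K \<Longrightarrow> (\<Sum>x\<in>K. \<pi> x y) \<le> b y"
    and supp: "\<And>x y. x \<in> K \<Longrightarrow> y \<in> K \<Longrightarrow> \<pi> x y \<noteq> 0 \<Longrightarrow> g x = g y"
  obtains \<pi>' where "\<And>x y. x \<in> K \<Longrightarrow> y \<in> K \<Longrightarrow> \<pi> x y \<le> \<pi>' x y"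
    and "\<And>x y. 0 \<le> \<pi>' x y"
    and "\<And>x. x \<in> K \<Longrightarrow> (\<Sum>y\<in>K. \<pi>' x y) \<le> a x"
    and "\<And>y. y \<in> K \<Longrightarrow> (\<Sum>x\<in>K. \<pi>' x y) \<le> b y"
    and "\<And>x y. x \<in> K \<Longrightarrow> y \<in> K \<Longrightarrow> \<pi>' x y \<noteq> 0 \<Longrightarrow> g x = g y"
    and "(\<Sum>x\<in>K. \<Sum>y\<in>K. \<pi>' x y) =
         (\<Sum>j\<in>J. min (\<Sum>x\<in>{x\<in>K. g x = j}. a x) (\<Sum>x\<in>{x\<in>K. g x = j}. b x))"
proof -
  define r where "r x = a x - (\<Sum>y\<in>K. \<pi> x y)" for x
  define s where "s y = b y - (\<Sum>x\<in>K. \<pi> x y)" for y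
  define \<alpha> where "\<alpha> j = (\<Sum>x\<in>{x\<in>K. g x = j}. r x)" for j
  define \<beta> where "\<beta> j = (\<Sum>x\<in>{x\<in>K. g x = j}. s x)" for j
  txt \<open>Dividing by the larger of the two residual cell masses exhausts the smaller one.\<close>
  define \<sigma> where "\<sigma> x y = (if x \<in> K \<and> y \<in> K \<and> g x = g y
    then r x * s y / max (\<alpha> (g x)) (\<beta> (g x)) else 0)" for x y
  have r0: "0 \<le> r x" if "x \<in> K" for x using row[OF that] by (simp add: r_def)
  have s0: "0 \<le> s x" if "x \<in> K" for x using col[OF that] by (simp add: s_def)
  have \<alpha>0: "0 \<le> \<alpha> j" for j unfolding \<alpha>_def by (rule sum_nonneg) (auto simp: r0)
  have \<beta>0: "0 \<le> \<beta> j" for j unfolding \<beta>_def by (rule sum_nonneg) (auto simp: s0)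
  have \<sigma>0: "0 \<le> \<sigma> x y" for x y
    using \<alpha>0[of "g x"] by (auto simp: \<sigma>_def intro!: divide_nonneg_nonneg mult_nonneg_nonneg r0 s0)
  have filt: "(\<Sum>y\<in>K. if g y = j then h y else 0) = (\<Sum>y\<in>{y\<in>K. g y = j}. h y)"
    for h :: "'k \<Rightarrow> real" and j
    using K by (simp add: sum.inter_filter)
  have \<sigma>row: "(\<Sum>y\<in>K. \<sigma> x y) = r x * (\<beta> (g x) / max (\<alpha> (g x)) (\<beta> (g x)))" if "x \<in> K" for x
  proof -
    have "(\<Sum>y\<in>K. \<sigma> x y) = (\<Sum>y\<in>K. if g y = g x then r x / max (\<alpha> (g x)) (\<beta> (g x)) * s y else 0)"
      using that by (intro sum.cong) (auto simp: \<sigma>_def)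
    also have "\<dots> = r x / max (\<alpha> (g x)) (\<beta> (g x)) * \<beta> (g x)"
      unfolding filt \<beta>_def by (simp add: sum_distrib_left)
    finally show ?thesis by simp
  qed
  have \<sigma>col: "(\<Sum>x\<in>K. \<sigma> x y) = s y * (\<alpha> (g y) / max (\<alpha> (g y)) (\<beta> (g y)))" if "y \<in> K" for y
  proof -
    have "(\<Sum>x\<in>K. \<sigma> x y) = (\<Sum>x\<in>K. if g x = g y then s y / max (\<alpha> (g y)) (\<beta> (g y)) * r x else 0)"
      using that by (intro sum.cong) (auto simp: \<sigma>_def)
    also have "\<dots> = s y / max (\<alpha> (g y)) (\<beta> (g y)) * \<alpha> (g y)"
      unfolding filt \<alpha>_def by (simp add: sum_distrib_left)
    finally show ?thesis by simp
  qed
  \<comment> \<open>If both residual masses are 0 the quotients are 0 / 0 = 0, which still satisfies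
    both bounds and \<open>min_eq\<close>.\<close>
  have frac: "\<beta> j / max (\<alpha> j) (\<beta> j) \<le> 1" "\<alpha> j / max (\<alpha> j) (\<beta> j) \<le> 1" for j
    using \<alpha>0[of j] \<beta>0[of j] by (auto simp: divide_le_eq_1 max_def)
  have min_eq: "\<alpha> j * (\<beta> j / max (\<alpha> j) (\<beta> j)) = min (\<alpha> j) (\<beta> j)" for j
    using \<alpha>0[of j] \<beta>0[of j] by (auto simp: max_def min_def)
  define \<rho> where "\<rho> j = (\<Sum>x\<in>{x\<in>K. g x = j}. \<Sum>y\<in>K. \<pi> x y)" for j
  \<comment> \<open>The support of \<open>\<pi>\<close> lies in the diagonal blocks, so the mass
    already matched in block \<open>j\<close> is the same counted by rows or by columns. It
    therefore lowers both cell masses by the same amount.\<close>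
  have \<rho>': "\<rho> j = (\<Sum>y\<in>{y\<in>K. g y = j}. \<Sum>x\<in>K. \<pi> x y)" for j
  proof -
    have "\<rho> j = (\<Sum>x\<in>K. \<Sum>y\<in>K. if g x = j then \<pi> x y else 0)"
      unfolding \<rho>_def filt[symmetric] by (intro sum.cong) auto
    also have "\<dots> = (\<Sum>x\<in>K. \<Sum>y\<in>K. if g y = j then \<pi> x y else 0)"
      using supp by (intro sum.cong refl) (metis (full_types))
    also have "\<dots> = (\<Sum>y\<in>K. \<Sum>x\<in>K. if g y = j then \<pi> x y else 0)"
      by (rule sum.swap)
    also have "\<dots> = (\<Sum>y\<in>{y\<in>K. g y = j}. \<Sum>x\<in>K. \<pi> x y)"
      unfolding filt[symmetric] by (intro sum.cong) auto
    finally show ?thesis .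
  qed
  have \<alpha>_eq: "(\<Sum>x\<in>{x\<in>K. g x = j}. a x) = \<alpha> j + \<rho> j" for j
    by (simp add: \<alpha>_def \<rho>_def r_def sum_subtractf)
  have \<beta>_eq: "(\<Sum>x\<in>{x\<in>K. g x = j}. b x) = \<beta> j + \<rho> j" for j
    by (simp add: \<beta>_def \<rho>' s_def sum_subtractf)
  show thesis
  proof
    show "\<pi> x y \<le> \<pi> x y + \<sigma> x y" for x y using \<sigma>0 by simp
    show "0 \<le> \<pi> x y + \<sigma> x y" for x y using \<sigma>0 nonneg by simp
    show "(\<Sum>y\<in>K. \<pi> x y + \<sigma> x y) \<le> a x" if "x \<in> K" for x
      using mult_left_le[OF frac(1) r0[OF that], of "g x"]
      by (simp add: sum.distrib \<sigma>row[OF that] r_def)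
    show "(\<Sum>x\<in>K. \<pi> x y + \<sigma> x y) \<le> b y" if "y \<in> K" for y
      using mult_left_le[OF frac(2) s0[OF that], of "g y"]
      by (simp add: sum.distrib \<sigma>col[OF that] s_def)
    show "g x = g y" if "x \<in> K" "y \<in> K" "\<pi> x y + \<sigma> x y \<noteq> 0" for x y
      using that supp[of x y] by (auto simp: \<sigma>_def split: if_splits)
    have "(\<Sum>x\<in>K. \<Sum>y\<in>K. \<pi> x y + \<sigma> x y) =
        (\<Sum>x\<in>K. (\<Sum>y\<in>K. \<pi> x y) + r x * (\<beta> (g x) / max (\<alpha> (g x)) (\<beta> (g x))))"
      by (intro sum.cong refl) (simp add: sum.distrib \<sigma>row)
    also have "\<dots> = (\<Sum>j\<in>J. \<Sum>x\<in>{x\<in>K. g x = j}.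
        (\<Sum>y\<in>K. \<pi> x y) + r x * (\<beta> (g x) / max (\<alpha> (g x)) (\<beta> (g x))))"
      by (rule sum.group[OF K J, symmetric])
    also have "\<dots> = (\<Sum>j\<in>J. \<Sum>x\<in>{x\<in>K. g x = j}.
        (\<Sum>y\<in>K. \<pi> x y) + r x * (\<beta> j / max (\<alpha> j) (\<beta> j)))"
      by (intro sum.cong refl) auto
    also have "\<dots> = (\<Sum>j\<in>J. \<rho> j + \<alpha> j * (\<beta> j / max (\<alpha> j) (\<beta> j)))"
      by (simp only: sum.distrib \<rho>_def \<alpha>_def sum_distrib_right)
    also have "\<dots> = (\<Sum>j\<in>J. min (\<alpha> j + \<rho> j) (\<beta> j + \<rho> j))"
      unfolding min_eq by (intro sum.cong refl) auto
    finally show "(\<Sum>x\<in>K. \<Sum>y\<in>K. \<pi> x y + \<sigma> x y) =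
        (\<Sum>j\<in>J. min (\<Sum>x\<in>{x\<in>K. g x = j}. a x) (\<Sum>x\<in>{x\<in>K. g x = j}. b x))"
      by (simp add: \<alpha>_eq \<beta>_eq)
  qed
qed

text \<open>The start is an arbitrary partial coupling, so that the output of one level can be the
  input of the next coarser one. Since \<open>\<pi>'\<close> dominates \<open>\<pi>\<close>, coarser
  levels never undo a match. The support condition is lost on the way and replaced by lower bounds
  for the diagonal masses.\<close>

lemma partial_coupling_refine:
  fixes a b :: "'k \<Rightarrow> real" and \<pi> :: "'k \<Rightarrow> 'k \<Rightarrow> real"
  assumes K: "finite K" and J: "\<And>l. finite (J l)" "\<And>l. l \<le> L \<Longrightarrow> f l ` K \<subseteq> J l"
    and refine: "\<And>l x y. l < L \<Longrightarrow> x \<in> K \<Longrightarrow> y \<in> K \<Longrightarrow> f (Suc l) x = f (Suc l) y \<Longrightarrow> f l x = f l y"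
    and nonneg: "\<And>x y. 0 \<le> \<pi> x y"
    and row: "\<And>x. x \<in> K \<Longrightarrow> (\<Sum>y\<in>K. \<pi> x y) \<le> a x"
    and col: "\<And>y. y \<in> K \<Longrightarrow> (\<Sum>x\<in>K. \<pi> x y) \<le> b y"
    and supp: "\<And>x y. x \<in> K \<Longrightarrow> y \<in> K \<Longrightarrow> \<pi> x y \<noteq> 0 \<Longrightarrow> f L x = f L y"
  shows "\<exists>\<pi>'. (\<forall>x\<in>K. \<forall>y\<in>K. \<pi> x y \<le> \<pi>' x y) \<and> (\<forall>x y. 0 \<le> \<pi>' x y) \<and>
    (\<forall>x\<in>K. (\<Sum>y\<in>K. \<pi>' x y) \<le> a x) \<and> (\<forall>y\<in>K. (\<Sum>x\<in>K. \<pi>' x y) \<le> b y) \<and>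
    (\<forall>l\<le>L. (\<Sum>j\<in>J l. min (\<Sum>x\<in>{x\<in>K. f l x = j}. a x) (\<Sum>x\<in>{x\<in>K. f l x = j}. b x))
       \<le> (\<Sum>x\<in>K. \<Sum>y\<in>K. if f l x = f l y then \<pi>' x y else 0))"
  using J(2) refine nonneg row col supp
proof (induction L arbitrary: \<pi>)
  case 0
  obtain \<tau> where \<tau>: "\<And>x y. x \<in> K \<Longrightarrow> y \<in> K \<Longrightarrow> \<pi> x y \<le> \<tau> x y" "\<And>x y. 0 \<le> \<tau> x y"
    "\<And>x. x \<in> K \<Longrightarrow> (\<Sum>y\<in>K. \<tau> x y) \<le> a x" "\<And>y. y \<in> K \<Longrightarrow> (\<Sum>x\<in>K. \<tau> x y) \<le> b y"
    "\<And>x y. x \<in> K \<Longrightarrow> y \<in> K \<Longrightarrow> \<tau> x y \<noteq> 0 \<Longrightarrow> f 0 x = f 0 y"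
    "(\<Sum>x\<in>K. \<Sum>y\<in>K. \<tau> x y) =
       (\<Sum>j\<in>J 0. min (\<Sum>x\<in>{x\<in>K. f 0 x = j}. a x) (\<Sum>x\<in>{x\<in>K. f 0 x = j}. b x))"
    by (rule partial_coupling_extend[OF K J(1)[of 0] "0.prems"(1)[OF le_refl] "0.prems"(3-6)])
      (assumption | rule that)+
  have "(\<Sum>x\<in>K. \<Sum>y\<in>K. if f 0 x = f 0 y then \<tau> x y else 0) = (\<Sum>x\<in>K. \<Sum>y\<in>K. \<tau> x y)"
    using \<tau>(5) by (intro sum.cong refl) auto
  then show ?case
    using \<tau> by (intro exI[of _ \<tau>]) auto
next
  case (Suc L)
  obtain \<tau> where \<tau>: "\<And>x y. x \<in> K \<Longrightarrow> y \<in> K \<Longrightarrow> \<pi> x y \<le> \<tau> x y" "\<And>x y. 0 \<le> \<tau> x y"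
    "\<And>x. x \<in> K \<Longrightarrow> (\<Sum>y\<in>K. \<tau> x y) \<le> a x" "\<And>y. y \<in> K \<Longrightarrow> (\<Sum>x\<in>K. \<tau> x y) \<le> b y"
    "\<And>x y. x \<in> K \<Longrightarrow> y \<in> K \<Longrightarrow> \<tau> x y \<noteq> 0 \<Longrightarrow> f (Suc L) x = f (Suc L) y"
    "(\<Sum>x\<in>K. \<Sum>y\<in>K. \<tau> x y) =
       (\<Sum>j\<in>J (Suc L). min (\<Sum>x\<in>{x\<in>K. f (Suc L) x = j}. a x) (\<Sum>x\<in>{x\<in>K. f (Suc L) x = j}. b x))"
    by (rule partial_coupling_extend[OF K J(1)[of "Suc L"] Suc.prems(1)[OF le_refl] Suc.prems(3-6)])
      (assumption | rule that)+
  \<comment> \<open>Pairs matched in a cell of level \<open>Suc L\<close> also share a cell of level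
    \<open>L\<close>, so \<open>\<tau>\<close> is a legitimate start for the induction
    hypothesis.\<close>
  have supp_L: "f L x = f L y" if "x \<in> K" "y \<in> K" "\<tau> x y \<noteq> 0" for x y
    using Suc.prems(2)[of L x y] \<tau>(5)[OF that] that by auto
  have "\<exists>\<pi>'. (\<forall>x\<in>K. \<forall>y\<in>K. \<tau> x y \<le> \<pi>' x y) \<and> (\<forall>x y. 0 \<le> \<pi>' x y) \<and>
    (\<forall>x\<in>K. (\<Sum>y\<in>K. \<pi>' x y) \<le> a x) \<and> (\<forall>y\<in>K. (\<Sum>x\<in>K. \<pi>' x y) \<le> b y) \<and>
    (\<forall>l\<le>L. (\<Sum>j\<in>J l. min (\<Sum>x\<in>{x\<in>K. f l x = j}. a x) (\<Sum>x\<in>{x\<in>K. f l x = j}. b x))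
       \<le> (\<Sum>x\<in>K. \<Sum>y\<in>K. if f l x = f l y then \<pi>' x y else 0))"
    by (rule Suc.IH[OF _ _ \<tau>(2-4) supp_L]) (auto intro: Suc.prems(2) subsetD[OF Suc.prems(1)])
  then obtain \<pi>' where \<pi>': "\<And>x y. x \<in> K \<Longrightarrow> y \<in> K \<Longrightarrow> \<tau> x y \<le> \<pi>' x y" "\<And>x y. 0 \<le> \<pi>' x y"
    "\<forall>x\<in>K. (\<Sum>y\<in>K. \<pi>' x y) \<le> a x" "\<forall>y\<in>K. (\<Sum>x\<in>K. \<pi>' x y) \<le> b y"
    and bound: "\<And>l. l \<le> L \<Longrightarrow> (\<Sum>j\<in>J l. min (\<Sum>x\<in>{x\<in>K. f l x = j}. a x) (\<Sum>x\<in>{x\<in>K. f l x = j}. b x))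
       \<le> (\<Sum>x\<in>K. \<Sum>y\<in>K. if f l x = f l y then \<pi>' x y else 0)"
    by blast
  \<comment> \<open>All of \<open>\<tau>\<close> sits on pairs sharing a cell of level
    \<open>Suc L\<close> and \<open>\<pi>'\<close> dominates it, so the mass matched at this level
    is still there at the end.\<close>
  have "(\<Sum>x\<in>K. \<Sum>y\<in>K. \<tau> x y) \<le>
      (\<Sum>x\<in>K. \<Sum>y\<in>K. if f (Suc L) x = f (Suc L) y then \<pi>' x y else 0)"
    using \<tau>(5) \<pi>'(1) by (intro sum_mono) force
  then have "\<forall>l\<le>Suc L. (\<Sum>j\<in>J l. min (\<Sum>x\<in>{x\<in>K. f l x = j}. a x) (\<Sum>x\<in>{x\<in>K. f l x = j}. b x))
       \<le> (\<Sum>x\<in>K. \<Sum>y\<in>K. if f l x = f l y then \<pi>' x y else 0)"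
    using bound by (auto simp: \<tau>(6) le_Suc_eq)
  moreover have "\<forall>x\<in>K. \<forall>y\<in>K. \<pi> x y \<le> \<pi>' x y"
    using \<tau>(1) \<pi>'(1) by (meson order_trans)
  ultimately show ?case
    using \<pi>' by (intro exI[of _ \<pi>']) blast
qed

text \<open>Level 0 has a single cell, where the minimum of the two masses is the full mass. The
  bound at this level therefore leaves nothing unmatched, and the partial coupling is a genuine
  one.\<close>

lemma discrete_multilevel_coupling:
  fixes a b :: "'k \<Rightarrow> real"
  assumes K: "finite K" and J: "\<And>l. finite (J l)" "\<And>l. l \<le> L \<Longrightarrow> f l ` K \<subseteq> J l" "J 0 = {c}"
    and refine: "\<And>l x y. l < L \<Longrightarrow> x \<in> K \<Longrightarrow> y \<in> K \<Longrightarrow> f (Suc l) x = f (Suc l) y \<Longrightarrow> f l x = f l y"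
    and a: "\<And>x. x \<in> K \<Longrightarrow> 0 \<le> a x" and b: "\<And>x. x \<in> K \<Longrightarrow> 0 \<le> b x" and "sum a K = sum b K"
  obtains \<pi> where "\<And>x y. 0 \<le> \<pi> x y"
    and "\<And>x. x \<in> K \<Longrightarrow> (\<Sum>y\<in>K. \<pi> x y) = a x" and "\<And>y. y \<in> K \<Longrightarrow> (\<Sum>x\<in>K. \<pi> x y) = b y"
    and "\<And>l. l \<le> L \<Longrightarrow>
      (\<Sum>j\<in>J l. min (\<Sum>x\<in>{x\<in>K. f l x = j}. a x) (\<Sum>x\<in>{x\<in>K. f l x = j}. b x))
        \<le> (\<Sum>x\<in>K. \<Sum>y\<in>K. if f l x = f l y then \<pi> x y else 0)"
proof -
  have "\<exists>\<pi>'. (\<forall>x\<in>K. \<forall>y\<in>K. 0 \<le> \<pi>' x y) \<and> (\<forall>x y. 0 \<le> \<pi>' x y) \<and>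
    (\<forall>x\<in>K. (\<Sum>y\<in>K. \<pi>' x y) \<le> a x) \<and> (\<forall>y\<in>K. (\<Sum>x\<in>K. \<pi>' x y) \<le> b y) \<and>
    (\<forall>l\<le>L. (\<Sum>j\<in>J l. min (\<Sum>x\<in>{x\<in>K. f l x = j}. a x) (\<Sum>x\<in>{x\<in>K. f l x = j}. b x))
       \<le> (\<Sum>x\<in>K. \<Sum>y\<in>K. if f l x = f l y then \<pi>' x y else 0))"
    by (rule partial_coupling_refine[OF K J(1,2) refine]) (auto simp: a b)
  then obtain \<pi> where \<pi>: "\<And>x y. 0 \<le> \<pi> x y"
    "\<And>x. x \<in> K \<Longrightarrow> (\<Sum>y\<in>K. \<pi> x y) \<le> a x" "\<And>y. y \<in> K \<Longrightarrow> (\<Sum>x\<in>K. \<pi> x y) \<le> b y"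
    and bound: "\<And>l. l \<le> L \<Longrightarrow>
      (\<Sum>j\<in>J l. min (\<Sum>x\<in>{x\<in>K. f l x = j}. a x) (\<Sum>x\<in>{x\<in>K. f l x = j}. b x))
        \<le> (\<Sum>x\<in>K. \<Sum>y\<in>K. if f l x = f l y then \<pi> x y else 0)"
    by blast
  have [simp]: "{x\<in>K. f 0 x = c} = K" using J(2)[of 0] J(3) by auto
  have "sum a K \<le> (\<Sum>x\<in>K. \<Sum>y\<in>K. if f 0 x = f 0 y then \<pi> x y else 0)"
    using bound[of 0] J(3) \<open>sum a K = sum b K\<close> by simp
  also have "\<dots> \<le> (\<Sum>x\<in>K. \<Sum>y\<in>K. \<pi> x y)"
    using \<pi>(1) by (intro sum_mono) auto
  finally have total: "sum a K \<le> (\<Sum>x\<in>K. \<Sum>y\<in>K. \<pi> x y)" .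
  have A: "(\<Sum>x\<in>K. \<Sum>y\<in>K. \<pi> x y) = sum a K"
    using total sum_mono[OF \<pi>(2)] by force
  moreover have B: "(\<Sum>y\<in>K. \<Sum>x\<in>K. \<pi> x y) = sum b K"
    using A \<open>sum a K = sum b K\<close> by (subst sum.swap) simp
  show thesis
  proof (rule that[OF \<pi>(1) _ _ bound])
    \<comment> \<open>Termwise inequalities whose totals agree are equalities.\<close>
    show "(\<Sum>y\<in>K. \<pi> x y) = a x" if "x \<in> K" for x
      by (rule sum_mono_inv[OF A \<pi>(2) that K])
    show "(\<Sum>x\<in>K. \<pi> x y) = b y" if "y \<in> K" for y
      by (rule sum_mono_inv[OF B \<pi>(3) that K])
  qed
qed

section \<open>Couplings with prescribed cell probabilities\<close>

lemma nn_integral_fibres: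
  assumes "finite K" and \<kappa>: "\<kappa> \<in> M \<rightarrow>\<^sub>M count_space K"
  shows "(\<integral>\<^sup>+x. F (\<kappa> x) \<partial>M) = (\<Sum>k\<in>K. F k * emeasure M {x \<in> space M. \<kappa> x = k})"
proof -
  have [measurable]: "{x \<in> space M. \<kappa> x = k} \<in> sets M" if "k \<in> K" for k
    using \<kappa> that by (intro measurable_sets_Collect[OF \<kappa>]) auto
  have "(\<integral>\<^sup>+x. F (\<kappa> x) \<partial>M) = (\<integral>\<^sup>+x. (\<Sum>k\<in>K. F k * indicator {x \<in> space M. \<kappa> x = k} x) \<partial>M)"
  proof (rule nn_integral_cong)
    fix x assume x: "x \<in> space M"
    then have "\<kappa> x \<in> K" using measurable_space[OF \<kappa>] by simp
    have "(\<Sum>k\<in>K. F k * indicator {x \<in> space M. \<kappa> x = k} x) = (\<Sum>k\<in>K. if \<kappa> x = k then F k else 0)"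
      using x by (intro sum.cong refl) (auto simp: indicator_def)
    then show "F (\<kappa> x) = (\<Sum>k\<in>K. F k * indicator {x \<in> space M. \<kappa> x = k} x)"
      using \<open>finite K\<close> \<open>\<kappa> x \<in> K\<close> by simp
  qed
  also have "\<dots> = (\<Sum>k\<in>K. F k * emeasure M {x \<in> space M. \<kappa> x = k})"
    by (subst nn_integral_sum) (auto simp: nn_integral_cmult_indicator)
  finally show ?thesis .
qed

lemma (in finite_measure) measure_fibres:
  assumes "finite K" and \<kappa>: "\<kappa> \<in> M \<rightarrow>\<^sub>M count_space K"
  shows "measure M {x \<in> space M. P (\<kappa> x)} =
    (\<Sum>k\<in>K. if P k then measure M {x \<in> space M. \<kappa> x = k} else 0)"
proof -
  have "{x \<in> space M. P (\<kappa> x)} = (\<Union>k\<in>{k\<in>K. P k}. {x \<in> space M. \<kappa> x = k})"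
    using measurable_space[OF \<kappa>] by auto
  moreover have "measure M \<dots> = (\<Sum>k\<in>{k\<in>K. P k}. measure M {x \<in> space M. \<kappa> x = k})"
    using \<open>finite K\<close> by (intro finite_measure_finite_Union)
      (auto simp: disjoint_family_on_def intro!: measurable_sets_Collect[OF \<kappa>])
  ultimately show ?thesis
    using \<open>finite K\<close> by (simp add: sum.inter_filter)
qed

text \<open>The null fibres are finitely many, so their union is null. This discards the points at
  which dividing by a cell mass would spoil the marginals.\<close>

lemma AE_fibre_nonnull:
  assumes "finite K" and \<kappa>: "\<kappa> \<in> M \<rightarrow>\<^sub>M count_space K"
  shows "AE x in M. emeasure M {y \<in> space M. \<kappa> y = \<kappa> x} \<noteq> 0"
proof -
  have "AE x in M. \<kappa> x \<noteq> k" if "emeasure M {y \<in> space M. \<kappa> y = k} = 0" "k \<in> K" for k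
    using that measurable_sets_Collect[OF \<kappa>, of "\<lambda>y. y = k"] by (intro AE_I[of _ _ "{y \<in> space M. \<kappa> y = k}"]) auto
  then have "AE x in M. \<forall>k\<in>K. emeasure M {y \<in> space M. \<kappa> y = k} = 0 \<longrightarrow> \<kappa> x \<noteq> k"
    using \<open>finite K\<close> by (intro AE_finite_allI) auto
  then show ?thesis
    using AE_space by eventually_elim (use measurable_space[OF \<kappa>] in auto)
qed

text \<open>Meant for \<open>w\<close> a row or column of a coupling of labels and \<open>c\<close>
  its sum: the integrand is then a section of the density in \<open>coupling_of_fibres\<close>, and
  integral 1 is what the marginals require.\<close>

lemma nn_integral_fibre_density:
  assumes "prob_space \<nu>" "finite K" and \<eta>: "\<eta> \<in> \<nu> \<rightarrow>\<^sub>M count_space K"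
    and nonneg: "\<And>k. k \<in> K \<Longrightarrow> 0 \<le> w k"
    and le: "\<And>k. k \<in> K \<Longrightarrow> w k \<le> measure \<nu> {y \<in> space \<nu>. \<eta> y = k}"
    and "sum w K = c" "c \<noteq> 0"
  shows "(\<integral>\<^sup>+y. ennreal (w (\<eta> y) / (c * measure \<nu> {y' \<in> space \<nu>. \<eta> y' = \<eta> y})) \<partial>\<nu>) = 1"
proof -
  interpret prob_space \<nu> by fact
  have "0 \<le> c" using nonneg \<open>sum w K = c\<close> sum_nonneg by blast
  have "(\<integral>\<^sup>+y. ennreal (w (\<eta> y) / (c * measure \<nu> {y' \<in> space \<nu>. \<eta> y' = \<eta> y})) \<partial>\<nu>) =
      (\<Sum>k\<in>K. ennreal (w k / (c * measure \<nu> {y \<in> space \<nu>. \<eta> y = k})) * emeasure \<nu> {y \<in> space \<nu>. \<eta> y = k})"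
    by (rule nn_integral_fibres[OF \<open>finite K\<close> \<eta>])
  also have "\<dots> = (\<Sum>k\<in>K. ennreal (w k / c))"
  proof (rule sum.cong[OF refl])
    fix k assume k: "k \<in> K"
    \<comment> \<open>Over a null fibre the bound \<open>le\<close> forces \<open>w k = 0\<close>,
      so both sides vanish.\<close>
    show "ennreal (w k / (c * measure \<nu> {y \<in> space \<nu>. \<eta> y = k})) * emeasure \<nu> {y \<in> space \<nu>. \<eta> y = k}
      = ennreal (w k / c)"
      using nonneg[OF k] le[OF k] \<open>0 \<le> c\<close>
      by (cases "measure \<nu> {y \<in> space \<nu>. \<eta> y = k} = 0")
        (auto simp: emeasure_eq_measure ennreal_mult'[symmetric])
  qed
  also have "\<dots> = ennreal (\<Sum>k\<in>K. w k / c)"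
    using nonneg \<open>0 \<le> c\<close> by (intro sum_ennreal) auto
  also have "(\<Sum>k\<in>K. w k / c) = 1"
    using assms(6,7) by (simp add: sum_divide_distrib[symmetric])
  finally show ?thesis by simp
qed

text \<open>Passes from a coupling of labels to one of the measures themselves. The density is
  constant on products of cells, so it only reweights them: their masses become
  \<open>\<pi>\<close>, and the row and column sums of \<open>\<pi>\<close> restore the
  marginals.\<close>

lemma coupling_of_fibres:
  fixes \<mu> :: "'a measure" and \<nu> :: "'b measure" and \<pi> :: "'k \<Rightarrow> 'l \<Rightarrow> real"
  assumes \<mu>: "prob_space \<mu>" and \<nu>: "prob_space \<nu>"
    and K: "finite K" and K': "finite K'"
    and \<kappa>: "\<kappa> \<in> \<mu> \<rightarrow>\<^sub>M count_space K" and \<eta>: "\<eta> \<in> \<nu> \<rightarrow>\<^sub>M count_space K'"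
    and nonneg: "\<And>k k'. 0 \<le> \<pi> k k'"
    and row: "\<And>k. k \<in> K \<Longrightarrow> (\<Sum>k'\<in>K'. \<pi> k k') = measure \<mu> {x \<in> space \<mu>. \<kappa> x = k}"
    and col: "\<And>k'. k' \<in> K' \<Longrightarrow> (\<Sum>k\<in>K. \<pi> k k') = measure \<nu> {y \<in> space \<nu>. \<eta> y = k'}"
  obtains M where "prob_space M" and "sets M = sets (\<mu> \<Otimes>\<^sub>M \<nu>)"
    and "distr M \<mu> fst = \<mu>" and "distr M \<nu> snd = \<nu>"
    and "\<And>k k'. k \<in> K \<Longrightarrow> k' \<in> K' \<Longrightarrow>
      measure M {z \<in> space M. \<kappa> (fst z) = k \<and> \<eta> (snd z) = k'} = \<pi> k k'"
proof -
  interpret \<mu>: prob_space \<mu> by fact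
  interpret \<nu>: prob_space \<nu> by fact
  interpret P: pair_prob_space \<mu> \<nu> ..
  define a where "a k = measure \<mu> {x \<in> space \<mu>. \<kappa> x = k}" for k
  define b where "b k = measure \<nu> {y \<in> space \<nu>. \<eta> y = k}" for k
  txt \<open>Given their cells the two coordinates are independent.  The divisions by 0 are harmless because
    \<open>\<pi>\<close> vanishes wherever \<open>a\<close> or \<open>b\<close> does.\<close>
  define h where "h x y = ennreal (\<pi> (\<kappa> x) (\<eta> y) / (a (\<kappa> x) * b (\<eta> y)))" for x y
  define M where "M = density (\<mu> \<Otimes>\<^sub>M \<nu>) (\<lambda>z. h (fst z) (snd z))"
  have \<pi>_a: "\<pi> k k' \<le> a k" if "k \<in> K" "k' \<in> K'" for k k'
    unfolding a_def row[OF that(1), symmetric] using nonneg K' that by (intro member_le_sum) auto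
  have \<pi>_b: "\<pi> k k' \<le> b k'" if "k \<in> K" "k' \<in> K'" for k k'
    unfolding b_def col[OF that(2), symmetric] using nonneg K that by (intro member_le_sum) auto
  have \<kappa>K: "\<kappa> x \<in> K" if "x \<in> space \<mu>" for x using measurable_space[OF \<kappa> that] by simp
  have \<eta>K: "\<eta> y \<in> K'" if "y \<in> space \<nu>" for y using measurable_space[OF \<eta> that] by simp
  \<comment> \<open>The product of the two finite count spaces is again a count space, so every
    function of the two labels is jointly measurable.\<close>
  have pair: "(\<lambda>z. (\<kappa> (fst z), \<eta> (snd z))) \<in> \<mu> \<Otimes>\<^sub>M \<nu> \<rightarrow>\<^sub>M count_space (K \<times> K')"
    using \<kappa> \<eta> K K'
    by (subst pair_measure_countable[symmetric]) (auto intro: countable_finite)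
  have h[measurable]: "(\<lambda>z. h (fst z) (snd z)) \<in> borel_measurable (\<mu> \<Otimes>\<^sub>M \<nu>)"
    unfolding h_def
    by (rule measurable_compose[OF pair, of "\<lambda>(k, k'). ennreal (\<pi> k k' / (a k * b k'))", simplified]) simp
  have h': "(\<lambda>(x, y). h x y) \<in> borel_measurable (\<mu> \<Otimes>\<^sub>M \<nu>)"
    using h by (simp add: case_prod_beta')
  \<comment> \<open>Only almost everywhere: on a null cell of \<open>\<mu>\<close> the density is 0
    by division by 0, and its section integrates to 0.\<close>
  have row1: "AE x in \<mu>. (\<integral>\<^sup>+y. h x y \<partial>\<nu>) = 1"
    using AE_fibre_nonnull[OF K \<kappa>] AE_space
  proof eventually_elim
    fix x assume x: "x \<in> space \<mu>" and "emeasure \<mu> {y \<in> space \<mu>. \<kappa> y = \<kappa> x} \<noteq> 0"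
    then have "a (\<kappa> x) \<noteq> 0" by (auto simp: a_def \<mu>.emeasure_eq_measure)
    then show "(\<integral>\<^sup>+y. h x y \<partial>\<nu>) = 1"
      unfolding h_def b_def
      by (intro nn_integral_fibre_density[OF \<nu> K' \<eta>])
        (auto simp: nonneg a_def row \<kappa>K[OF x] intro!: \<pi>_b[unfolded b_def])
  qed
  have col1: "AE y in \<nu>. (\<integral>\<^sup>+x. h x y \<partial>\<mu>) = 1"
    using AE_fibre_nonnull[OF K' \<eta>] AE_space
  proof eventually_elim
    fix y assume y: "y \<in> space \<nu>" and "emeasure \<nu> {x \<in> space \<nu>. \<eta> x = \<eta> y} \<noteq> 0"
    then have "b (\<eta> y) \<noteq> 0" by (auto simp: b_def \<nu>.emeasure_eq_measure)
    then show "(\<integral>\<^sup>+x. h x y \<partial>\<mu>) = 1"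
      unfolding h_def a_def mult.commute[of _ "b (\<eta> y)"]
      by (intro nn_integral_fibre_density[OF \<mu> K \<kappa>])
        (auto simp: nonneg b_def col \<eta>K[OF y] intro!: \<pi>_a[unfolded a_def])
  qed
  have space_M: "space M = space \<mu> \<times> space \<nu>"
    by (simp add: M_def space_pair_measure)
  have sets_M[measurable_cong]: "sets M = sets (\<mu> \<Otimes>\<^sub>M \<nu>)" by (simp add: M_def)
  have em_fst: "emeasure M (A \<times> space \<nu>) = emeasure \<mu> A" if [measurable]: "A \<in> sets \<mu>" for A
  proof -
    have "emeasure M (A \<times> space \<nu>) =
        (\<integral>\<^sup>+z. h (fst z) (snd z) * indicator (A \<times> space \<nu>) z \<partial>(\<mu> \<Otimes>\<^sub>M \<nu>))"
      unfolding M_def by (subst emeasure_density) auto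
    also have "\<dots> = (\<integral>\<^sup>+x. \<integral>\<^sup>+y. h x y * indicator (A \<times> space \<nu>) (x, y) \<partial>\<nu> \<partial>\<mu>)"
      by (subst \<nu>.nn_integral_fst[symmetric]) auto
    also have "\<dots> = (\<integral>\<^sup>+x. indicator A x * (\<integral>\<^sup>+y. h x y \<partial>\<nu>) \<partial>\<mu>)"
    proof (rule nn_integral_cong)
      fix x assume x: "x \<in> space \<mu>"
      have "(\<integral>\<^sup>+y. h x y * indicator (A \<times> space \<nu>) (x, y) \<partial>\<nu>) = (\<integral>\<^sup>+y. indicator A x * h x y \<partial>\<nu>)"
        by (intro nn_integral_cong) (auto simp: indicator_def)
      also have "\<dots> = indicator A x * (\<integral>\<^sup>+y. h x y \<partial>\<nu>)"
        using measurable_Pair2[OF h' x] by (intro nn_integral_cmult) simp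
      finally show "(\<integral>\<^sup>+y. h x y * indicator (A \<times> space \<nu>) (x, y) \<partial>\<nu>) = indicator A x * (\<integral>\<^sup>+y. h x y \<partial>\<nu>)" .
    qed
    also have "\<dots> = (\<integral>\<^sup>+x. indicator A x \<partial>\<mu>)"
      using row1 by (intro nn_integral_cong_AE) (auto elim: eventually_mono)
    finally show ?thesis by simp
  qed
  have em_snd: "emeasure M (space \<mu> \<times> A) = emeasure \<nu> A" if [measurable]: "A \<in> sets \<nu>" for A
  proof -
    have "emeasure M (space \<mu> \<times> A) =
        (\<integral>\<^sup>+z. h (fst z) (snd z) * indicator (space \<mu> \<times> A) z \<partial>(\<mu> \<Otimes>\<^sub>M \<nu>))"
      unfolding M_def by (subst emeasure_density) auto
    also have "\<dots> = (\<integral>\<^sup>+y. \<integral>\<^sup>+x. h x y * indicator (space \<mu> \<times> A) (x, y) \<partial>\<mu> \<partial>\<nu>)"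
      by (subst P.nn_integral_snd[symmetric]) (auto simp: case_prod_beta')
    also have "\<dots> = (\<integral>\<^sup>+y. indicator A y * (\<integral>\<^sup>+x. h x y \<partial>\<mu>) \<partial>\<nu>)"
    proof (rule nn_integral_cong)
      fix y assume y: "y \<in> space \<nu>"
      have "(\<integral>\<^sup>+x. h x y * indicator (space \<mu> \<times> A) (x, y) \<partial>\<mu>) = (\<integral>\<^sup>+x. indicator A y * h x y \<partial>\<mu>)"
        by (intro nn_integral_cong) (auto simp: indicator_def)
      also have "\<dots> = indicator A y * (\<integral>\<^sup>+x. h x y \<partial>\<mu>)"
        using measurable_Pair1[OF h' y] by (intro nn_integral_cmult) simp
      finally show "(\<integral>\<^sup>+x. h x y * indicator (space \<mu> \<times> A) (x, y) \<partial>\<mu>) = indicator A y * (\<integral>\<^sup>+x. h x y \<partial>\<mu>)" .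
    qed
    also have "\<dots> = (\<integral>\<^sup>+y. indicator A y \<partial>\<nu>)"
      using col1 by (intro nn_integral_cong_AE) (auto elim: eventually_mono)
    finally show ?thesis by simp
  qed
  show thesis
  proof
    show "prob_space M"
      using em_fst[OF sets.top] by (intro prob_spaceI) (simp add: space_M \<mu>.emeasure_space_1)
    show "sets M = sets (\<mu> \<Otimes>\<^sub>M \<nu>)" by (fact sets_M)
    show "distr M \<mu> fst = \<mu>"
    proof (rule measure_eqI)
      fix A assume "A \<in> sets (distr M \<mu> fst)"
      then have A: "A \<in> sets \<mu>" by simp
      have "fst -` A \<inter> space M = A \<times> space \<nu>"
        using sets.sets_into_space[OF A] by (auto simp: space_M)
      then show "emeasure (distr M \<mu> fst) A = emeasure \<mu> A"
        using A em_fst[OF A] by (simp add: emeasure_distr)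
    qed simp
    show "distr M \<nu> snd = \<nu>"
    proof (rule measure_eqI)
      fix A assume "A \<in> sets (distr M \<nu> snd)"
      then have A: "A \<in> sets \<nu>" by simp
      have "snd -` A \<inter> space M = space \<mu> \<times> A"
        using sets.sets_into_space[OF A] by (auto simp: space_M)
      then show "emeasure (distr M \<nu> snd) A = emeasure \<nu> A"
        using A em_snd[OF A] by (simp add: emeasure_distr)
    qed simp
    fix k k' assume k: "k \<in> K" and k': "k' \<in> K'"
    define A where "A = {x \<in> space \<mu>. \<kappa> x = k}"
    define B where "B = {y \<in> space \<nu>. \<eta> y = k'}"
    have [measurable]: "A \<in> sets \<mu>" "B \<in> sets \<nu>"
      unfolding A_def B_def by (auto intro!: measurable_sets_Collect[OF \<kappa>] measurable_sets_Collect[OF \<eta>] simp: k k')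
    have "{z \<in> space M. \<kappa> (fst z) = k \<and> \<eta> (snd z) = k'} = A \<times> B"
      by (auto simp: space_M A_def B_def)
    moreover have "emeasure M (A \<times> B) = ennreal (\<pi> k k')"
    proof -
      have "emeasure M (A \<times> B) = (\<integral>\<^sup>+z. h (fst z) (snd z) * indicator (A \<times> B) z \<partial>(\<mu> \<Otimes>\<^sub>M \<nu>))"
        unfolding M_def by (subst emeasure_density) auto
      also have "\<dots> = (\<integral>\<^sup>+z. ennreal (\<pi> k k' / (a k * b k')) * indicator (A \<times> B) z \<partial>(\<mu> \<Otimes>\<^sub>M \<nu>))"
        by (intro nn_integral_cong) (auto simp: indicator_def h_def A_def B_def)
      also have "\<dots> = ennreal (\<pi> k k' / (a k * b k')) * (emeasure \<mu> A * emeasure \<nu> B)"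
        by (subst nn_integral_cmult_indicator) (auto simp: \<nu>.emeasure_pair_measure_Times)
      also have "\<dots> = ennreal (\<pi> k k' / (a k * b k') * (a k * b k'))"
        using nonneg by (simp only: \<mu>.emeasure_eq_measure \<nu>.emeasure_eq_measure a_def b_def A_def B_def
            ennreal_mult[symmetric] measure_nonneg mult_nonneg_nonneg divide_nonneg_nonneg)
      \<comment> \<open>If \<open>a k\<close> or \<open>b k'\<close> is 0, then so is
        \<open>\<pi> k k'\<close> by the two bounds, and both sides are 0.\<close>
      also have "\<pi> k k' / (a k * b k') * (a k * b k') = \<pi> k k'"
        using \<pi>_a[OF k k'] \<pi>_b[OF k k'] nonneg[of k k'] by auto
      finally show ?thesis .
    qed
    ultimately show "measure M {z \<in> space M. \<kappa> (fst z) = k \<and> \<eta> (snd z) = k'} = \<pi> k k'"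
      using nonneg by (simp add: measure_def)
  qed
qed

section \<open>Greedy couplings and the Wasserstein distance\<close>

text \<open>The label of level \<open>L\<close> determines all coarser ones, so a coupling of these
  labels decides at every level up to \<open>L\<close> whether a cell is shared. The probabilities
  of these events are unchanged when the labels are lifted to points.\<close>

theorem multilevel_coupling:
  fixes \<mu> \<nu> :: "'a measure" and \<kappa> :: "nat \<Rightarrow> 'a \<Rightarrow> 'k"
  assumes \<mu>: "prob_space \<mu>" and \<nu>: "prob_space \<nu>" and sets_eq: "sets \<nu> = sets \<mu>"
    and J: "\<And>l. finite (J l)" "J 0 = {c}"
    and \<kappa>: "\<And>l. \<kappa> l \<in> \<mu> \<rightarrow>\<^sub>M count_space (J l)"
    and refine: "\<And>l x y. x \<in> space \<mu> \<Longrightarrow> y \<in> space \<mu> \<Longrightarrow>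
      \<kappa> (Suc l) x = \<kappa> (Suc l) y \<Longrightarrow> \<kappa> l x = \<kappa> l y"
  obtains M where "prob_space M" and "sets M = sets (\<mu> \<Otimes>\<^sub>M \<nu>)"
    and "distr M \<mu> fst = \<mu>" and "distr M \<nu> snd = \<nu>"
    and "\<And>l. l \<le> L \<Longrightarrow>
      1 - (\<Sum>j\<in>J l. \<bar>measure \<mu> {x \<in> space \<mu>. \<kappa> l x = j} - measure \<nu> {x \<in> space \<nu>. \<kappa> l x = j}\<bar>) / 2
        \<le> measure M {z \<in> space M. \<kappa> l (fst z) = \<kappa> l (snd z)}"
proof -
  interpret \<mu>: prob_space \<mu> by fact
  interpret \<nu>: prob_space \<nu> by fact
  have space_eq: "space \<nu> = space \<mu>" using sets_eq by (rule sets_eq_imp_space_eq)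
  \<comment> \<open>The image rather than \<open>J L\<close>: every label must have a representative
    point, from which \<open>f\<close> reads off the coarser labels.\<close>
  define K where "K = \<kappa> L ` space \<mu>"
  define rep where "rep k = (SOME x. x \<in> space \<mu> \<and> \<kappa> L x = k)" for k
  have rep: "rep k \<in> space \<mu>" "\<kappa> L (rep k) = k" if "k \<in> K" for k
  proof -
    have "\<exists>x. x \<in> space \<mu> \<and> \<kappa> L x = k" using that by (auto simp: K_def)
    from someI_ex[OF this] show "rep k \<in> space \<mu>" "\<kappa> L (rep k) = k"
      by (auto simp: rep_def)
  qed
  define f where "f l k = \<kappa> l (rep k)" for l k
  have "K \<subseteq> J L" using measurable_space[OF \<kappa>] by (auto simp: K_def)
  then have K: "finite K" using J(1) finite_subset by blast
  have coarser: "\<kappa> l x = \<kappa> l y" if "l \<le> L" "x \<in> space \<mu>" "y \<in> space \<mu>" "\<kappa> L x = \<kappa> L y" for l x y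
    using that(1)
  proof (induction rule: inc_induct)
    case base
    show ?case by (rule that(4))
  next
    case (step n)
    then show ?case using refine[OF that(2,3)] by blast
  qed
  have f: "f l (\<kappa> L x) = \<kappa> l x" if "l \<le> L" "x \<in> space \<mu>" for l x
    unfolding f_def using that rep[of "\<kappa> L x"] by (metis coarser K_def imageI)
  have fJ: "f l ` K \<subseteq> J l" for l
    using measurable_space[OF \<kappa>[of l]] rep by (auto simp: f_def)
  have \<kappa>\<mu>: "\<kappa> L \<in> \<mu> \<rightarrow>\<^sub>M count_space K"
    using \<kappa>[of L] K J(1) \<open>K \<subseteq> J L\<close> by (auto simp: measurable_count_space_eq2 K_def)
  then have \<kappa>\<nu>: "\<kappa> L \<in> \<nu> \<rightarrow>\<^sub>M count_space K"
    using measurable_cong_sets[OF sets_eq refl] by blast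
  define a where "a k = measure \<mu> {x \<in> space \<mu>. \<kappa> L x = k}" for k
  define b where "b k = measure \<nu> {x \<in> space \<nu>. \<kappa> L x = k}" for k
  have sum_a: "(\<Sum>k\<in>{k\<in>K. f l k = j}. a k) = measure \<mu> {x \<in> space \<mu>. \<kappa> l x = j}"
    if "l \<le> L" for l j
  proof -
    have "{x \<in> space \<mu>. \<kappa> l x = j} = {x \<in> space \<mu>. f l (\<kappa> L x) = j}" using f that by auto
    then show ?thesis
      using \<mu>.measure_fibres[OF K \<kappa>\<mu>, of "\<lambda>k. f l k = j"] K by (simp add: a_def sum.inter_filter)
  qed
  have sum_b: "(\<Sum>k\<in>{k\<in>K. f l k = j}. b k) = measure \<nu> {x \<in> space \<nu>. \<kappa> l x = j}"
    if "l \<le> L" for l j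
  proof -
    have "{x \<in> space \<nu>. \<kappa> l x = j} = {x \<in> space \<nu>. f l (\<kappa> L x) = j}" using f that space_eq by auto
    then show ?thesis
      using \<nu>.measure_fibres[OF K \<kappa>\<nu>, of "\<lambda>k. f l k = j"] K by (simp add: b_def sum.inter_filter)
  qed
  have a0: "0 \<le> a k" and b0: "0 \<le> b k" for k by (simp_all add: a_def b_def)
  have "sum a K = 1"
    using \<mu>.measure_fibres[OF K \<kappa>\<mu>, of "\<lambda>_. True"] by (simp add: a_def \<mu>.prob_space)
  moreover have "sum b K = 1"
    using \<nu>.measure_fibres[OF K \<kappa>\<nu>, of "\<lambda>_. True"] by (simp add: b_def \<nu>.prob_space)
  ultimately have total: "sum a K = sum b K" by simp
  have refine_f: "f l k = f l k'"
    if "k \<in> K" "k' \<in> K" "f (Suc l) k = f (Suc l) k'" for l k k'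
    using that refine rep unfolding f_def by blast
  obtain \<pi> where \<pi>: "\<And>x y. 0 \<le> \<pi> x y"
    "\<And>x. x \<in> K \<Longrightarrow> (\<Sum>y\<in>K. \<pi> x y) = a x" "\<And>y. y \<in> K \<Longrightarrow> (\<Sum>x\<in>K. \<pi> x y) = b y"
    and same: "\<And>l. l \<le> L \<Longrightarrow>
      (\<Sum>j\<in>J l. min (\<Sum>x\<in>{x\<in>K. f l x = j}. a x) (\<Sum>x\<in>{x\<in>K. f l x = j}. b x))
        \<le> (\<Sum>x\<in>K. \<Sum>y\<in>K. if f l x = f l y then \<pi> x y else 0)"
    by (rule discrete_multilevel_coupling[where f = f and J = J and L = L and a = a and b = b,
          OF K J(1) fJ J(2) refine_f a0 b0 total])
      (assumption | rule that)+
  obtain M where M: "prob_space M" "sets M = sets (\<mu> \<Otimes>\<^sub>M \<nu>)"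
    "distr M \<mu> fst = \<mu>" "distr M \<nu> snd = \<nu>"
    and \<pi>_M: "\<And>k k'. k \<in> K \<Longrightarrow> k' \<in> K \<Longrightarrow>
      measure M {z \<in> space M. \<kappa> L (fst z) = k \<and> \<kappa> L (snd z) = k'} = \<pi> k k'"
    by (rule coupling_of_fibres[where \<kappa> = "\<kappa> L" and \<eta> = "\<kappa> L" and \<pi> = \<pi>,
        OF \<mu> \<nu> K K \<kappa>\<mu> \<kappa>\<nu> \<pi>(1) \<pi>(2)[unfolded a_def] \<pi>(3)[unfolded b_def]])
      (assumption | rule that)+
  interpret M: prob_space M by fact
  have space_M: "space M = space \<mu> \<times> space \<mu>"
    using sets_eq_imp_space_eq[OF M(2)] by (simp add: space_pair_measure space_eq)
  have pair: "(\<lambda>z. (\<kappa> L (fst z), \<kappa> L (snd z))) \<in> M \<rightarrow>\<^sub>M count_space (K \<times> K)"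
    unfolding measurable_cong_sets[OF M(2) refl] using \<kappa>\<mu> \<kappa>\<nu> K
    by (subst pair_measure_countable[symmetric]) (auto intro: countable_finite)
  show thesis
  proof (rule that[OF M])
    fix l assume l: "l \<le> L"
    define u where "u j = measure \<mu> {x \<in> space \<mu>. \<kappa> l x = j}" for j
    define v where "v j = measure \<nu> {x \<in> space \<nu>. \<kappa> l x = j}" for j
    have "sum u (J l) = 1"
      using \<mu>.measure_fibres[OF J(1) \<kappa>[of l], of "\<lambda>_. True"] by (simp add: u_def \<mu>.prob_space)
    moreover have \<kappa>\<nu>_l: "\<kappa> l \<in> \<nu> \<rightarrow>\<^sub>M count_space (J l)"
      using \<kappa> measurable_cong_sets[OF sets_eq refl] by blast
    moreover have "sum v (J l) = 1"
      using \<nu>.measure_fibres[OF J(1) \<kappa>\<nu>_l, of "\<lambda>_. True"] by (simp add: v_def \<nu>.prob_space)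
    \<comment> \<open>Both families sum to 1, so this identity turns the sum of minima into 1 minus
      half the l1-distance.\<close>
    moreover have "(\<Sum>j\<in>J l. min (u j) (v j)) = (\<Sum>j\<in>J l. (u j + v j - \<bar>u j - v j\<bar>) / 2)"
      by (intro sum.cong) (auto simp: min_def)
    ultimately have "1 - (\<Sum>j\<in>J l. \<bar>u j - v j\<bar>) / 2 = (\<Sum>j\<in>J l. min (u j) (v j))"
      by (simp add: sum_divide_distrib[symmetric] sum_subtractf sum.distrib diff_divide_distrib)
    also have "\<dots> \<le> (\<Sum>x\<in>K. \<Sum>y\<in>K. if f l x = f l y then \<pi> x y else 0)"
      using same[OF l] sum_a[OF l] sum_b[OF l] by (simp add: u_def v_def)
    also have "\<dots> = (\<Sum>k\<in>K \<times> K. if f l (fst k) = f l (snd k)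
        then measure M {z \<in> space M. (\<kappa> L (fst z), \<kappa> L (snd z)) = k} else 0)"
      unfolding sum.cartesian_product by (intro sum.cong) (auto simp: \<pi>_M)
    also have "\<dots> = measure M {z \<in> space M. f l (\<kappa> L (fst z)) = f l (\<kappa> L (snd z))}"
      using M.measure_fibres[OF _ pair, of "\<lambda>k. f l (fst k) = f l (snd k)"] K by simp
    also have "{z \<in> space M. f l (\<kappa> L (fst z)) = f l (\<kappa> L (snd z))} =
        {z \<in> space M. \<kappa> l (fst z) = \<kappa> l (snd z)}"
      using f[OF l] by (auto simp: space_M)
    finally show "1 - (\<Sum>j\<in>J l. \<bar>measure \<mu> {x \<in> space \<mu>. \<kappa> l x = j} - measure \<nu> {x \<in> space \<nu>. \<kappa> l x = j}\<bar>) / 2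
        \<le> measure M {z \<in> space M. \<kappa> l (fst z) = \<kappa> l (snd z)}"
      by (simp add: u_def v_def)
  qed
qed

section \<open>From couplings to bounds for the Wasserstein distance\<close>

lemma wasserstein_powr_le:
  fixes M :: "('a::real_vector \<times> 'a) measure" and \<mu> \<nu> :: "'a measure"
  assumes "p > 0" and "prob_space M"
    and "X \<in> M \<rightarrow>\<^sub>M \<mu>" "distr M \<mu> X = \<mu>" and "Y \<in> M \<rightarrow>\<^sub>M \<nu>" "distr M \<nu> Y = \<nu>"
    and "integrable M (\<lambda>\<omega>. N (X \<omega> - Y \<omega>) powr p)"
  shows "wasserstein p N \<mu> \<nu> powr p \<le> (\<integral>\<omega>. N (X \<omega> - Y \<omega>) powr p \<partial>M)"
proof -
  let ?I = "\<integral>\<omega>. N (X \<omega> - Y \<omega>) powr p \<partial>M"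
  let ?S = "{(\<integral>\<omega>. N (X \<omega> - Y \<omega>) powr p \<partial>M) powr (1 / p) | (M :: ('a \<times> 'a) measure) X Y.
            prob_space M \<and>
            X \<in> M \<rightarrow>\<^sub>M \<mu> \<and> distr M \<mu> X = \<mu> \<and>
            Y \<in> M \<rightarrow>\<^sub>M \<nu> \<and> distr M \<nu> Y = \<nu> \<and>
            integrable M (\<lambda>\<omega>. N (X \<omega> - Y \<omega>) powr p)}"
  have mem: "?I powr (1 / p) \<in> ?S"
    unfolding mem_Collect_eq using assms by (intro exI[of _ M] exI[of _ X] exI[of _ Y]) simp
  have "wasserstein p N \<mu> \<nu> \<le> ?I powr (1 / p)"
    unfolding wasserstein_def by (rule cInf_lower[OF mem]) (auto intro!: bdd_belowI[of _ 0])
  \<comment> \<open>Needed to raise the inequality to the power \<open>p\<close>. Here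
    \<open>mem\<close> supplies nonemptiness, without which the value of \<open>Inf\<close> says
    nothing.\<close>
  moreover have "0 \<le> wasserstein p N \<mu> \<nu>"
    unfolding wasserstein_def using mem by (intro cInf_greatest) auto
  ultimately have "wasserstein p N \<mu> \<nu> powr p \<le> (?I powr (1 / p)) powr p"
    using \<open>p > 0\<close> by (intro powr_mono2) auto
  also have "\<dots> = ?I"
    using \<open>p > 0\<close> by (simp add: powr_powr)
  finally show ?thesis .
qed

text \<open>Abel summation for one pair of points: \<open>I l\<close> stands for sharing a cell of
  level \<open>l\<close>, and \<open>c\<close> for the cost. Since 2^(-p(l-1)) - 2^(-pl) = (2^p - 1)
  2^(-pl), the bracket telescopes to 2^(-pm) for the largest m <= n with \<open>I m\<close>. The
  second claim, with \<open>I\<close> constantly true, later evaluates a geometric sum.\<close>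

lemma hierarchical_cost_le:
  fixes p c D :: real
  assumes "I 0" and mono: "\<And>l. I (Suc l) \<Longrightarrow> I l"
    and bound: "\<And>l. I l \<Longrightarrow> c \<le> D * 2 powr (- p * real l)"
  shows "c \<le> D * (1 - (2 powr p - 1) * (\<Sum>l = 1..n. 2 powr (- p * real l) * of_bool (I l)))"
    and "I n \<Longrightarrow> 1 - (2 powr p - 1) * (\<Sum>l = 1..n. 2 powr (- p * real l) * of_bool (I l)) =
      2 powr (- p * real n)"
proof -
  define R where "R n = 1 - (2 powr p - 1) * (\<Sum>l = 1..n. 2 powr (- p * real l) * of_bool (I l))" for n
  \<comment> \<open>The exact value at \<open>n\<close> is carried along: if
    \<open>I (Suc n)\<close> holds, \<open>mono\<close> gives \<open>I n\<close>, and the remainder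
    drops from one power to the next; otherwise it does not change.\<close>
  have "c \<le> D * R n \<and> (I n \<longrightarrow> R n = 2 powr (- p * real n))"
  proof (induction n)
    case 0
    then show ?case using bound[OF \<open>I 0\<close>] by (simp add: R_def)
  next
    case (Suc n)
    have step: "2 powr (- p * real n) = 2 powr p * 2 powr (- p * real (Suc n))"
      by (simp add: powr_add[symmetric] algebra_simps)
    show ?case
    proof (cases "I (Suc n)")
      case True
      have "R (Suc n) = R n - (2 powr p - 1) * 2 powr (- p * real (Suc n))"
        using True by (simp add: R_def algebra_simps)
      also have "\<dots> = 2 powr (- p * real (Suc n))"
        using Suc mono[OF True] step by (simp add: algebra_simps)
      finally show ?thesis using bound[OF True] by simp
    next
      case False
      then have "R (Suc n) = R n" by (simp add: R_def)
      then show ?thesis using Suc False by simp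
    qed
  qed
  then show "c \<le> D * (1 - (2 powr p - 1) * (\<Sum>l = 1..n. 2 powr (- p * real l) * of_bool (I l)))"
    "I n \<Longrightarrow> 1 - (2 powr p - 1) * (\<Sum>l = 1..n. 2 powr (- p * real l) * of_bool (I l)) =
      2 powr (- p * real n)"
    by (auto simp: R_def)
qed

text \<open>The pointwise cost bound is affine in the indicators of the events \<open>E l\<close>,
  with nonpositive coefficients \<open>- q * w l\<close> inside the bracket. Integration therefore
  turns lower bounds for their probabilities into an upper bound for the cost.\<close>

theorem wasserstein_multilevel:
  fixes \<mu> \<nu> :: "('a::real_vector) measure" and \<kappa> :: "nat \<Rightarrow> 'a \<Rightarrow> 'k" and D p :: real
  assumes "p > 0" and \<mu>: "prob_space \<mu>" and \<nu>: "prob_space \<nu>" and sets_eq: "sets \<nu> = sets \<mu>"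
    and J: "\<And>l. finite (J l)" "J 0 = {c}"
    and \<kappa>: "\<And>l. \<kappa> l \<in> \<mu> \<rightarrow>\<^sub>M count_space (J l)"
    and refine: "\<And>l x y. x \<in> space \<mu> \<Longrightarrow> y \<in> space \<mu> \<Longrightarrow>
      \<kappa> (Suc l) x = \<kappa> (Suc l) y \<Longrightarrow> \<kappa> l x = \<kappa> l y"
    and N: "(\<lambda>z. N (fst z - snd z)) \<in> borel_measurable (\<mu> \<Otimes>\<^sub>M \<nu>)"
    and N_nonneg: "\<And>x. 0 \<le> N x" and "0 \<le> D"
    and diam: "\<And>l x y. x \<in> space \<mu> \<Longrightarrow> y \<in> space \<mu> \<Longrightarrow> \<kappa> l x = \<kappa> l y \<Longrightarrow> N (x - y) \<le> D / 2 ^ l"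
  shows "wasserstein p N \<mu> \<nu> powr p \<le> D powr p *
    ((2 powr p - 1) / 2 * (\<Sum>l = 1..L. 2 powr (- p * real l) *
       (\<Sum>j\<in>J l. \<bar>measure \<mu> {x \<in> space \<mu>. \<kappa> l x = j} - measure \<nu> {x \<in> space \<nu>. \<kappa> l x = j}\<bar>))
     + 2 powr (- p * real L))"
proof -
  define w where "w l = 2 powr (- p * real l)" for l
  define \<Delta> where "\<Delta> l = (\<Sum>j\<in>J l. \<bar>measure \<mu> {x \<in> space \<mu>. \<kappa> l x = j} -
    measure \<nu> {x \<in> space \<nu>. \<kappa> l x = j}\<bar>)" for l
  define q where "q = 2 powr p - 1"
  have "q \<ge> 0" using \<open>p > 0\<close> by (simp add: q_def ge_one_powr_ge_zero)
  obtain M where M: "prob_space M" "sets M = sets (\<mu> \<Otimes>\<^sub>M \<nu>)"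
    "distr M \<mu> fst = \<mu>" "distr M \<nu> snd = \<nu>"
    and same0: "\<And>l. l \<le> L \<Longrightarrow>
      1 - (\<Sum>j\<in>J l. \<bar>measure \<mu> {x \<in> space \<mu>. \<kappa> l x = j} - measure \<nu> {x \<in> space \<nu>. \<kappa> l x = j}\<bar>) / 2
        \<le> measure M {z \<in> space M. \<kappa> l (fst z) = \<kappa> l (snd z)}"
    by (rule multilevel_coupling[where \<kappa> = \<kappa> and J = J and c = c and L = L, OF \<mu> \<nu> sets_eq J \<kappa> refine])
      (assumption | rule that)+
  note same = same0[folded \<Delta>_def]
  interpret M: prob_space M by fact
  have space_eq: "space \<nu> = space \<mu>" using sets_eq by (rule sets_eq_imp_space_eq)
  have space_M: "space M = space \<mu> \<times> space \<mu>"
    using sets_eq_imp_space_eq[OF M(2)] by (simp add: space_pair_measure space_eq)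
  define E where "E l = {z \<in> space M. \<kappa> l (fst z) = \<kappa> l (snd z)}" for l
  have E[measurable]: "E l \<in> sets M" for l
  proof -
    have "\<kappa> l \<in> \<nu> \<rightarrow>\<^sub>M count_space (J l)"
      using \<kappa> measurable_cong_sets[OF sets_eq refl] by blast
    then have "(\<lambda>z. (\<kappa> l (fst z), \<kappa> l (snd z))) \<in> M \<rightarrow>\<^sub>M count_space (J l \<times> J l)"
      unfolding measurable_cong_sets[OF M(2) refl] using \<kappa> J(1)
      by (subst pair_measure_countable[symmetric]) (auto intro: countable_finite)
    from measurable_sets_Collect[OF this, of "\<lambda>(j, j'). j = j'"] show ?thesis
      by (simp add: E_def)
  qed
  have pointwise: "N (fst z - snd z) powr p \<le> D powr p * (1 - q * (\<Sum>l = 1..L. w l * indicator (E l) z))"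
    if z: "z \<in> space M" for z
  proof -
    have ind: "indicator (E l) z = (of_bool (\<kappa> l (fst z) = \<kappa> l (snd z)) :: real)" for l
      using z by (simp add: E_def indicator_def)
    have z': "fst z \<in> space \<mu>" "snd z \<in> space \<mu>" using z by (auto simp: space_M)
    show ?thesis
      unfolding ind q_def w_def
    proof (rule hierarchical_cost_le)
      show "\<kappa> 0 (fst z) = \<kappa> 0 (snd z)"
        using measurable_space[OF \<kappa>[of 0]] z' J(2) by auto
      show "\<kappa> l (fst z) = \<kappa> l (snd z)" if "\<kappa> (Suc l) (fst z) = \<kappa> (Suc l) (snd z)" for l
        by (rule refine[OF z' that])
      fix l assume "\<kappa> l (fst z) = \<kappa> l (snd z)"
      then have "N (fst z - snd z) \<le> D / 2 ^ l"
        by (rule diam[OF z'])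
      then have "N (fst z - snd z) powr p \<le> (D / 2 ^ l) powr p"
        using \<open>p > 0\<close> N_nonneg by (intro powr_mono2) auto
      also have "\<dots> = D powr p * 2 powr (- p * real l)"
        using \<open>0 \<le> D\<close>
        by (simp add: powr_divide powr_realpow[symmetric] powr_powr powr_minus divide_simps mult.commute)
      finally show "N (fst z - snd z) powr p \<le> D powr p * 2 powr (- p * real l)" .
    qed
  qed
  have int_rhs: "integrable M (\<lambda>z. D powr p * (1 - q * (\<Sum>l = 1..L. w l * indicator (E l) z)))"
    by (intro integrable_mult_right Bochner_Integration.integrable_diff Bochner_Integration.integrable_sum
        integrable_real_indicator M.integrable_const) (auto simp: M.emeasure_eq_measure)
  have [measurable]: "(\<lambda>z. N (fst z - snd z)) \<in> borel_measurable M"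
    using N measurable_cong_sets[OF M(2) refl] by blast
  \<comment> \<open>A finite combination of indicators dominates the cost, so this coupling is
    admissible in the infimum.\<close>
  have int: "integrable M (\<lambda>z. N (fst z - snd z) powr p)"
    using int_rhs by (rule Bochner_Integration.integrable_bound) (auto dest!: pointwise intro!: AE_I2)
  have "wasserstein p N \<mu> \<nu> powr p \<le> (\<integral>z. N (fst z - snd z) powr p \<partial>M)"
  proof (rule wasserstein_powr_le[OF \<open>p > 0\<close> M(1) _ M(3) _ M(4) int])
    show "fst \<in> M \<rightarrow>\<^sub>M \<mu>" "snd \<in> M \<rightarrow>\<^sub>M \<nu>"
      unfolding measurable_cong_sets[OF M(2) refl] by simp_all
  qed
  also have "\<dots> \<le> (\<integral>z. D powr p * (1 - q * (\<Sum>l = 1..L. w l * indicator (E l) z)) \<partial>M)"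
    by (rule integral_mono[OF int int_rhs pointwise])
  also have "\<dots> = D powr p * (1 - q * (\<Sum>l = 1..L. w l * measure M (E l)))"
  proof -
    define S where "S z = (\<Sum>l = 1..L. w l * indicator (E l) z)" for z
    have iE: "integrable M (\<lambda>z. w l * indicator (E l) z)" for l
      by (intro integrable_mult_right integrable_real_indicator) (auto simp: M.emeasure_eq_measure)
    have iS: "integrable M S"
      unfolding S_def by (intro Bochner_Integration.integrable_sum iE)
    have "integral\<^sup>L M S = (\<Sum>l = 1..L. w l * measure M (E l))"
      unfolding S_def by (subst Bochner_Integration.integral_sum[OF iE]) simp
    then show ?thesis
      unfolding S_def[symmetric] using iS by (simp add: M.prob_space)
  qed
  also have "\<dots> \<le> D powr p * (1 - q * (\<Sum>l = 1..L. w l * (1 - \<Delta> l / 2)))"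
    using same \<open>q \<ge> 0\<close>
    by (intro mult_left_mono diff_left_mono sum_mono) (auto simp: E_def w_def)
  also have "1 - q * (\<Sum>l = 1..L. w l * (1 - \<Delta> l / 2)) =
      q / 2 * (\<Sum>l = 1..L. w l * \<Delta> l) + (1 - q * (\<Sum>l = 1..L. w l))"
    by (simp add: right_diff_distrib sum_subtractf sum_divide_distrib[symmetric])
  \<comment> \<open>This is the pointwise remainder in the case where all levels are shared.\<close>
  also have "1 - q * (\<Sum>l = 1..L. w l) = w L"
    using hierarchical_cost_le(2)[of "\<lambda>_. True" 0 0 p L] by (simp add: q_def w_def)
  finally show ?thesis
    by (simp add: w_def q_def \<Delta>_def)
qed

section \<open>Dyadic cubes\<close>

text \<open>The truncation by \<open>nat\<close> puts coordinates equal to 0 into the lowest cell, so the fibres of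
  \<open>cell_index\<close> on the closed cube are the cells of the modified partition.\<close>

definition cell_index :: "nat \<Rightarrow> real ^ 'd \<Rightarrow> 'd \<Rightarrow> nat" where
  "cell_index l u = (\<lambda>i. nat (\<lceil>2 ^ l * u $ i\<rceil> - 1))"

definition cell_indices :: "nat \<Rightarrow> ('d \<Rightarrow> nat) set" where
  "cell_indices l = {k. \<forall>i. k i < 2 ^ l}"

lemma finite_cell_indices: "finite (cell_indices l :: ('d::finite \<Rightarrow> nat) set)"
proof -
  have "(cell_indices l :: ('d \<Rightarrow> nat) set) = PiE UNIV (\<lambda>_. {..<2 ^ l})"
    by (auto simp: cell_indices_def PiE_def)
  then show ?thesis by (simp add: finite_PiE)
qed

lemma cell_indices_0: "cell_indices 0 = {\<lambda>_. 0}"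
  by (auto simp: cell_indices_def)

lemma nat_ceiling_minus_one_eq_iff:
  fixes x :: real
  shows "nat (\<lceil>x\<rceil> - 1) = k \<longleftrightarrow> (if k = 0 then x \<le> 1 else real k < x \<and> x \<le> real k + 1)"
proof (cases "k = 0")
  case True
  have "nat (\<lceil>x\<rceil> - 1) = 0 \<longleftrightarrow> \<lceil>x\<rceil> \<le> 1" by auto
  then show ?thesis using True by (simp add: ceiling_le_iff)
next
  case False
  then have "nat (\<lceil>x\<rceil> - 1) = k \<longleftrightarrow> \<lceil>x\<rceil> = int k + 1" by auto
  also have "\<dots> \<longleftrightarrow> real k < x \<and> x \<le> real k + 1" by (simp add: ceiling_eq_iff)
  finally show ?thesis using False by simp
qed

text \<open>The truncated index is 0 for negative coordinates too, hence the separate condition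
  \<open>0 \<le> u $ i\<close>. Where \<open>k i > 0\<close> it follows from the lower bound of the
  cell.\<close>

lemma dyadic_cube'_eq: "dyadic_cube' l k = {u. (\<forall>i. 0 \<le> u $ i) \<and> cell_index l u = k}"
proof -
  have "(if k i = 0 then 0 \<le> x else real (k i) / 2 ^ l < x) \<and> x \<le> (real (k i) + 1) / 2 ^ l
      \<longleftrightarrow> 0 \<le> x \<and> nat (\<lceil>2 ^ l * x\<rceil> - 1) = k i" for i and x :: real
  proof -
    have "0 \<le> x" if "real (k i) / 2 ^ l < x"
      using that by (meson divide_nonneg_pos less_imp_le of_nat_0_le_iff order_le_less_trans zero_less_numeral zero_less_power)
    then show ?thesis
      unfolding nat_ceiling_minus_one_eq_iff by (auto simp: field_simps)
  qed
  then show ?thesis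
    unfolding dyadic_cube'_def cell_index_def by (auto simp: fun_eq_iff)
qed

lemma cell_index_in_indices:
  assumes "u \<in> unit_cube"
  shows "cell_index l u \<in> cell_indices l"
proof -
  have "nat (\<lceil>2 ^ l * u $ i\<rceil> - 1) < 2 ^ l" for i
  proof -
    have "2 ^ l * u $ i \<le> 2 ^ l * 1"
      using assms by (intro mult_left_mono) (auto simp: unit_cube_def)
    then have "\<lceil>2 ^ l * u $ i\<rceil> \<le> 2 ^ l" by (simp add: ceiling_le_iff)
    moreover have "(0::int) < 2 ^ l" by simp
    ultimately show ?thesis by (simp add: nat_less_iff)
  qed
  then show ?thesis by (simp add: cell_indices_def cell_index_def)
qed

lemma dyadic_cube'_subset:
  assumes "k \<in> cell_indices l"
  shows "dyadic_cube' l k \<subseteq> unit_cube"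
proof
  fix u assume u: "u \<in> dyadic_cube' l k"
  have "u $ i \<le> 1" for i
  proof -
    have "u $ i \<le> (real (k i) + 1) / 2 ^ l" using u by (auto simp: dyadic_cube'_def)
    also have "\<dots> \<le> 1"
    proof -
      have "k i + 1 \<le> 2 ^ l" using assms by (auto simp: cell_indices_def Suc_le_eq)
      then have "real (k i + 1) \<le> real (2 ^ l)" by (rule of_nat_mono)
      then show ?thesis by simp
    qed
    finally show ?thesis .
  qed
  then show "u \<in> unit_cube" using u by (auto simp: dyadic_cube'_eq unit_cube_def)
qed

lemma fibre_cell_index:
  assumes "k \<in> cell_indices l"
  shows "{u \<in> unit_cube. cell_index l u = k} = dyadic_cube' l k"
  using dyadic_cube'_subset[OF assms] by (auto simp: dyadic_cube'_eq unit_cube_def)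

text \<open>Right-closed intervals nest under halving: for c the ceiling of 2x and q = (c - 1) div
  2, one has 2q <= c - 1 < 2x <= c <= 2q + 2. Hence each level of cells refines the previous
  one.\<close>

lemma nat_ceiling_minus_one_div_2:
  fixes x :: real
  shows "nat (\<lceil>x\<rceil> - 1) = nat (\<lceil>2 * x\<rceil> - 1) div 2"
proof -
  have "\<lceil>x\<rceil> = (\<lceil>2 * x\<rceil> - 1) div 2 + 1"
  proof -
    define c where "c = \<lceil>2 * x\<rceil>"
    define q where "q = (c - 1) div 2"
    have "2 * q \<le> c - 1" "c - 1 \<le> 2 * q + 1" unfolding q_def by presburger+
    moreover have "real_of_int c - 1 < 2 * x" "2 * x \<le> real_of_int c"
      unfolding c_def by linarith+
    ultimately have "real_of_int q < x" "x \<le> real_of_int q + 1" by linarith+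
    then have "\<lceil>x\<rceil> = q + 1" by (simp add: ceiling_eq_iff)
    then show ?thesis by (simp add: q_def c_def)
  qed
  then have "\<lceil>x\<rceil> - 1 = (\<lceil>2 * x\<rceil> - 1) div 2" by simp
  moreover have "nat (z div 2) = nat z div 2" for z :: int by (simp add: nat_div_distrib')
  ultimately show ?thesis by simp
qed

lemma cell_index_Suc: "cell_index l u i = cell_index (Suc l) u i div 2"
  unfolding cell_index_def using nat_ceiling_minus_one_div_2[of "2 ^ l * u $ i"]
  by (simp add: mult.assoc)

lemma dyadic_cube'_borel [measurable]: "dyadic_cube' l (k :: 'd::finite \<Rightarrow> nat) \<in> sets borel"
proof -
  have "dyadic_cube' l k = (\<Inter>i. {u. (if k i = 0 then 0 \<le> u $ i else real (k i) / 2 ^ l < u $ i) \<and>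
             u $ i \<le> (real (k i) + 1) / 2 ^ l})"
    by (auto simp: dyadic_cube'_def)
  also have "\<dots> \<in> sets borel" by measurable
  finally show ?thesis .
qed

lemma measurable_cell_index:
  fixes \<mu> :: "(real ^ 'd) measure"
  assumes "sets \<mu> = sets (restrict_space borel unit_cube)"
  shows "cell_index l \<in> \<mu> \<rightarrow>\<^sub>M count_space (cell_indices l)"
proof -
  have space: "space \<mu> = unit_cube"
    using sets_eq_imp_space_eq[OF assms] by (simp add: space_restrict_space)
  have "cell_index l -` {k} \<inter> space \<mu> \<in> sets \<mu>" if k: "k \<in> cell_indices l" for k
  proof -
    have "cell_index l -` {k} \<inter> space \<mu> = unit_cube \<inter> dyadic_cube' l k"
      using fibre_cell_index[OF k] by (auto simp: space)
    then show ?thesis by (auto simp: assms sets_restrict_space)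
  qed
  then show ?thesis
    using cell_index_in_indices by (auto simp: measurable_count_space_eq2 finite_cell_indices space)
qed

section \<open>Comparison of the two dyadic partitions\<close>

lemma upper_corner_in_dyadic_cube: "(\<chi> i. (real (k i) + 1) / 2 ^ l) \<in> dyadic_cube l k"
  by (simp add: dyadic_cube_def divide_strict_right_mono)

lemma dyadic_cube_subset: "dyadic_cube l k \<subseteq> dyadic_cube' l k"
proof
  fix u assume "u \<in> dyadic_cube l k"
  then have *: "real (k i) / 2 ^ l < u $ i" "u $ i \<le> (real (k i) + 1) / 2 ^ l" for i
    by (auto simp: dyadic_cube_def)
  then show "u \<in> dyadic_cube' l k" unfolding dyadic_cube'_def
    by (auto intro: less_imp_le dest: spec) (metis * div_0 less_imp_le of_nat_0)
qed

text \<open>The two kinds of cubes differ only on the faces u_i = 0, whose mass vanishes in case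
  (a).\<close>

lemma dyadic_cube_eq:
  assumes "k \<in> cell_indices l"
  shows "dyadic_cube l k = dyadic_cube' l k \<inter> semiopen_unit_cube"
proof (intro equalityI subsetI IntI)
  fix u assume u: "u \<in> dyadic_cube l k"
  then show u': "u \<in> dyadic_cube' l k" using dyadic_cube_subset by blast
  have "0 < u $ i" for i
    using u by (auto simp: dyadic_cube_def intro: order_le_less_trans[rotated])
  then show "u \<in> semiopen_unit_cube"
    using u' dyadic_cube'_subset[OF assms] by (auto simp: semiopen_unit_cube_def unit_cube_def)
next
  fix u assume u: "u \<in> dyadic_cube' l k \<inter> semiopen_unit_cube"
  show "u \<in> dyadic_cube l k" unfolding dyadic_cube_def
  proof (intro CollectI allI)
    fix i
    have "(if k i = 0 then 0 \<le> u $ i else real (k i) / 2 ^ l < u $ i) \<and> u $ i \<le> (real (k i) + 1) / 2 ^ l"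
      "0 < u $ i"
      using u by (auto simp: dyadic_cube'_def semiopen_unit_cube_def)
    then show "real (k i) / 2 ^ l < u $ i \<and> u $ i \<le> (real (k i) + 1) / 2 ^ l"
      by (cases "k i = 0") auto
  qed
qed

text \<open>The partitions are sets of cubes, so summing over indices instead requires different
  indices to give different cubes. Cells are closed at the top, so the upper corner belongs to its
  cube, and \<open>cell_index\<close> recovers \<open>k\<close> from it.\<close>

lemma inj_dyadic_cube: "inj (dyadic_cube l :: ('d::finite \<Rightarrow> nat) \<Rightarrow> _)"
  and inj_dyadic_cube': "inj (dyadic_cube' l :: ('d::finite \<Rightarrow> nat) \<Rightarrow> _)"
proof -
  have corner: "cell_index l (\<chi> i. (real (k i) + 1) / 2 ^ l) = k" for k :: "'d \<Rightarrow> nat"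
    using upper_corner_in_dyadic_cube[of k l] dyadic_cube_subset[of l k] by (auto simp: dyadic_cube'_eq)
  show "inj (dyadic_cube l :: ('d \<Rightarrow> nat) \<Rightarrow> _)"
  proof (rule injI)
    fix k k' :: "'d \<Rightarrow> nat" assume "dyadic_cube l k = dyadic_cube l k'"
    then have "(\<chi> i. (real (k i) + 1) / 2 ^ l) \<in> dyadic_cube' l k'"
      using upper_corner_in_dyadic_cube dyadic_cube_subset by blast
    then show "k = k'" by (simp add: dyadic_cube'_eq corner)
  qed
  show "inj (dyadic_cube' l :: ('d \<Rightarrow> nat) \<Rightarrow> _)"
  proof (rule injI)
    fix k k' :: "'d \<Rightarrow> nat" assume "dyadic_cube' l k = dyadic_cube' l k'"
    then have "(\<chi> i. (real (k i) + 1) / 2 ^ l) \<in> dyadic_cube' l k'"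
      using upper_corner_in_dyadic_cube dyadic_cube_subset by blast
    then show "k = k'" by (simp add: dyadic_cube'_eq corner)
  qed
qed

lemma sum_dyadic_partition:
  fixes h :: "(real ^ 'd) set \<Rightarrow> real"
  shows "(\<Sum>F\<in>dyadic_partition l. h F) = (\<Sum>k\<in>cell_indices l. h (dyadic_cube l k))"
proof -
  have "(dyadic_partition l :: (real ^ 'd) set set) = dyadic_cube l ` cell_indices l"
    by (auto simp: dyadic_partition_def cell_indices_def)
  then show ?thesis
    by (simp add: sum.reindex[OF inj_on_subset[OF inj_dyadic_cube subset_UNIV]])
qed

lemma sum_dyadic_partition':
  fixes h :: "(real ^ 'd) set \<Rightarrow> real"
  shows "(\<Sum>F\<in>dyadic_partition' l. h F) = (\<Sum>k\<in>cell_indices l. h (dyadic_cube' l k))"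
proof -
  have "(dyadic_partition' l :: (real ^ 'd) set set) = dyadic_cube' l ` cell_indices l"
    by (auto simp: dyadic_partition'_def cell_indices_def)
  then show ?thesis
    by (simp add: sum.reindex[OF inj_on_subset[OF inj_dyadic_cube' subset_UNIV]])
qed

lemma measure_dyadic_cube_eq:
  fixes \<mu> :: "(real ^ 'd) measure"
  assumes \<mu>: "prob_space \<mu>" and sets: "sets \<mu> = sets (restrict_space borel unit_cube)"
    and one: "measure \<mu> semiopen_unit_cube = 1" and k: "k \<in> cell_indices l"
  shows "measure \<mu> (dyadic_cube l k) = measure \<mu> (dyadic_cube' l k)"
proof -
  interpret prob_space \<mu> by fact
  \<comment> \<open>A set outside the sigma-algebra has \<open>measure\<close> 0 by default, so mass
    1 implies measurability.\<close>
  have S: "semiopen_unit_cube \<in> sets \<mu>"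
    using one measure_notin_sets by fastforce
  have C: "dyadic_cube' l k \<in> sets \<mu>"
    using dyadic_cube'_subset[OF k] dyadic_cube'_borel[of l k] by (auto simp: sets sets_restrict_space)
  have "AE u in \<mu>. u \<in> semiopen_unit_cube" using one by (rule AE_prob_1)
  then show ?thesis
    unfolding dyadic_cube_eq[OF k] using S C by (intro finite_measure_eq_AE) auto
qed

section \<open>Arbitrary norms on R^d and the diameter of cells\<close>

lemma is_norm_le_norm:
  fixes N :: "real ^ 'd \<Rightarrow> real"
  assumes "is_norm N"
  shows "N x \<le> (\<Sum>i\<in>UNIV. N (axis i 1)) * norm x"
proof -
  have tri: "N (x + y) \<le> N x + N y" and hom: "N (c *\<^sub>R x) = \<bar>c\<bar> * N x" and zero: "N 0 = 0"
    and nonneg: "0 \<le> N x" for x y c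
    using assms by (auto simp: is_norm_def)
  have sum_le: "N (sum g A) \<le> (\<Sum>i\<in>A. N (g i))" if "finite A" for g and A :: "'d set"
    using that by (induction rule: finite_induct) (auto simp: zero intro: order_trans[OF tri])
  have "x = (\<Sum>i\<in>UNIV. (x $ i) *\<^sub>R axis i 1)"
    by (simp add: vec_eq_iff sum_component axis_def if_distrib cong: if_cong)
  then have "N x \<le> (\<Sum>i\<in>UNIV. N ((x $ i) *\<^sub>R axis i 1))"
    by (metis sum_le finite)
  also have "\<dots> \<le> (\<Sum>i\<in>UNIV. N (axis i 1) * norm x)"
    unfolding hom by (intro sum_mono) (simp add: mult.commute mult_right_mono component_le_norm_cart nonneg mult_left_mono)
  finally show ?thesis by (simp add: sum_distrib_right)
qed

text \<open>Domination by the Euclidean norm makes \<open>N\<close> Lipschitz; continuity is what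
  makes the cost Borel measurable.\<close>

lemma is_norm_continuous:
  fixes N :: "real ^ 'd \<Rightarrow> real"
  assumes "is_norm N"
  shows "continuous_on UNIV N"
proof -
  define C where "C = (\<Sum>i\<in>UNIV. N (axis i 1))"
  have tri: "N (x + y) \<le> N x + N y" and hom: "N (c *\<^sub>R x) = \<bar>c\<bar> * N x"
    and nonneg: "0 \<le> N x" for x y c
    using assms by (auto simp: is_norm_def)
  have "C \<ge> 0" unfolding C_def by (intro sum_nonneg nonneg)
  have "\<bar>N x - N y\<bar> \<le> C * norm (x - y)" for x y
  proof -
    have "N x \<le> N y + N (x - y)" using tri[of y "x - y"] by simp
    moreover have "N y \<le> N x + N (y - x)" using tri[of x "y - x"] by simp
    moreover have "N (y - x) = N (x - y)" using hom[of "-1" "x - y"] by simp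
    moreover have "N (x - y) \<le> C * norm (x - y)" unfolding C_def by (rule is_norm_le_norm[OF assms])
    ultimately show ?thesis by linarith
  qed
  then have "C-lipschitz_on UNIV N"
    using \<open>C \<ge> 0\<close> by (intro lipschitz_onI) (auto simp: dist_norm)
  then show ?thesis by (rule lipschitz_on_continuous_on)
qed

text \<open>The diameter is a supremum over the semi-open cube, whereas (b) also has points on the
  faces u_i = 0. Moving both points inside costs a factor \<open>1 - t\<close> in their distance,
  which disappears as \<open>t\<close> tends to 0.\<close>

lemma norm_unit_cube_le_diameter:
  fixes N :: "real ^ 'd \<Rightarrow> real"
  assumes N: "is_norm N" and x: "x \<in> unit_cube" and y: "y \<in> unit_cube"
  shows "N (x - y) \<le> norm_diameter N semiopen_unit_cube"
proof -
  let ?S = "semiopen_unit_cube :: (real ^ 'd) set"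
  let ?D = "norm_diameter N ?S"
  have hom: "N (c *\<^sub>R x) = \<bar>c\<bar> * N x" and nonneg: "0 \<le> N x" for x c
    using N by (auto simp: is_norm_def)
  have "bounded ?S"
    by (rule bounded_subset[OF bounded_cbox[of 0 1]]) (auto simp: semiopen_unit_cube_def mem_box_cart less_imp_le)
  then obtain B where B: "\<And>x. x \<in> ?S \<Longrightarrow> norm x \<le> B" by (auto simp: bounded_iff)
  \<comment> \<open>A real \<open>SUP\<close> is known to bound its members only when the set is
    bounded above.\<close>
  have "bdd_above ((\<lambda>(x, y). N (y - x)) ` (?S \<times> ?S))"
  proof (rule bdd_aboveI2, clarify)
    fix x y :: "real ^ 'd" assume xy: "x \<in> ?S" "y \<in> ?S"
    have "N (y - x) \<le> (\<Sum>i\<in>UNIV. N (axis i 1)) * norm (y - x)" by (rule is_norm_le_norm[OF N])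
    also have "\<dots> \<le> (\<Sum>i\<in>UNIV. N (axis i 1)) * (B + B)"
      using B[OF xy(1)] B[OF xy(2)] norm_triangle_ineq4[of y x]
      by (intro mult_left_mono sum_nonneg nonneg) auto
    finally show "N (y - x) \<le> (\<Sum>i\<in>UNIV. N (axis i 1)) * (B + B)" .
  qed
  then have le: "N (v - u) \<le> ?D" if "u \<in> ?S" "v \<in> ?S" for u v
    unfolding norm_diameter_def using that by (intro cSUP_upper2[of _ _ "(u, v)"]) auto
  have "(1 - t) * N (x - y) \<le> ?D" if t: "0 < t" "t < 1" for t
  proof -
    txt \<open>Contracting towards the corner \<open>(1, \<dots>, 1)\<close> moves the closed cube into the semi-open one.\<close>
    define s where "s z = (\<chi> i. t + (1 - t) * z $ i)" for z :: "real ^ 'd"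
    have s: "s z \<in> ?S" if z: "z \<in> unit_cube" for z
      unfolding semiopen_unit_cube_def
    proof (intro CollectI allI)
      fix i
      have "0 \<le> (1 - t) * z $ i" "(1 - t) * z $ i \<le> 1 - t"
        using z t by (auto simp: unit_cube_def mult_left_le)
      then show "0 < s z $ i \<and> s z $ i \<le> 1"
        unfolding s_def vec_lambda_beta using t by linarith
    qed
    have "s x - s y = (1 - t) *\<^sub>R (x - y)" by (simp add: s_def vec_eq_iff algebra_simps)
    then show ?thesis using le[OF s[OF y] s[OF x]] hom[of "1 - t" "x - y"] t by simp
  qed
  then have "eventually (\<lambda>t. (1 - t) * N (x - y) \<le> ?D) (at_right 0)"
    by (auto simp: eventually_at_right_field intro!: exI[of _ 1])
  moreover have "((\<lambda>t. (1 - t) * N (x - y)) \<longlongrightarrow> (1 - 0) * N (x - y)) (at_right 0)"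
    by (intro tendsto_intros)
  ultimately show ?thesis
    using tendsto_upperbound[of _ _ "at_right (0::real)"] by fastforce
qed

text \<open>The map z -> 2^l z - k sends the cell into the closed unit cube and multiplies
  \<open>N\<close>-distances by 2^l.\<close>

lemma norm_same_cell_le:
  fixes N :: "real ^ 'd \<Rightarrow> real"
  assumes N: "is_norm N" and x: "x \<in> unit_cube" and y: "y \<in> unit_cube"
    and same: "cell_index l x = cell_index l y"
  shows "N (x - y) \<le> norm_diameter N semiopen_unit_cube / 2 ^ l"
proof -
  define k where "k = cell_index l x"
  define s where "s z = (\<chi> i. 2 ^ l * z $ i - real (k i))" for z :: "real ^ 'd"
  have s: "s z \<in> unit_cube" if "z \<in> unit_cube" "cell_index l z = k" for z
  proof -
    have "z \<in> dyadic_cube' l k" using that by (auto simp: dyadic_cube'_eq unit_cube_def)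
    then have "(if k i = 0 then 0 \<le> z $ i else real (k i) / 2 ^ l < z $ i) \<and>
        z $ i \<le> (real (k i) + 1) / 2 ^ l" for i
      by (auto simp: dyadic_cube'_def)
    then have "0 \<le> 2 ^ l * z $ i - real (k i) \<and> 2 ^ l * z $ i - real (k i) \<le> 1" for i
      by (cases "k i = 0") (auto simp: field_simps less_imp_le dest!: spec[of _ i] meta_spec[of _ i])
    then show ?thesis by (simp add: unit_cube_def s_def)
  qed
  have "N (s x - s y) \<le> norm_diameter N semiopen_unit_cube"
    using x y same by (intro norm_unit_cube_le_diameter[OF N] s) (auto simp: k_def)
  moreover have "s x - s y = 2 ^ l *\<^sub>R (x - y)" by (simp add: s_def vec_eq_iff algebra_simps)
  moreover have "N (2 ^ l *\<^sub>R (x - y)) = 2 ^ l * N (x - y)"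
    using N unfolding is_norm_def by (metis abs_numeral power_abs)
  ultimately show ?thesis by (simp add: field_simps)
qed

lemma norm_measurable_unit_cube:
  fixes N :: "real ^ 'd \<Rightarrow> real" and \<mu> \<nu> :: "(real ^ 'd) measure"
  assumes N: "is_norm N" and \<mu>: "sets \<mu> = sets (restrict_space borel unit_cube)"
    and \<nu>: "sets \<nu> = sets (restrict_space borel unit_cube)"
  shows "(\<lambda>z. N (fst z - snd z)) \<in> borel_measurable (\<mu> \<Otimes>\<^sub>M \<nu>)"
proof -
  have [measurable]: "N \<in> borel_measurable borel"
    using is_norm_continuous[OF N] by (rule borel_measurable_continuous_onI)
  have id: "(\<lambda>x. x) \<in> restrict_space borel unit_cube \<rightarrow>\<^sub>M (borel :: (real ^ 'd) measure)"
    by (intro measurable_restrict_space1) simp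
  have [measurable]: "(\<lambda>x. x) \<in> \<mu> \<rightarrow>\<^sub>M borel" "(\<lambda>x. x) \<in> \<nu> \<rightarrow>\<^sub>M borel"
    using id measurable_cong_sets[OF \<mu> refl] measurable_cong_sets[OF \<nu> refl] by blast+
  have [measurable]: "fst \<in> \<mu> \<Otimes>\<^sub>M \<nu> \<rightarrow>\<^sub>M borel" "snd \<in> \<mu> \<Otimes>\<^sub>M \<nu> \<rightarrow>\<^sub>M borel"
    using measurable_compose[OF measurable_fst, of "\<lambda>x. x" \<mu> borel \<nu>]
      measurable_compose[OF measurable_snd, of "\<lambda>x. x" \<nu> borel \<mu>] by simp_all
  show ?thesis by measurable
qed

section \<open>Dyadic bounds for the Wasserstein distance\<close>

lemma wasserstein_dyadic_finite:
  fixes N :: "real ^ 'd \<Rightarrow> real" and \<mu> \<nu> :: "(real ^ 'd) measure" and p :: real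
  assumes "p \<ge> 1" and N: "is_norm N"
    and \<mu>: "prob_space \<mu>" "sets \<mu> = sets (restrict_space borel unit_cube)"
    and \<nu>: "prob_space \<nu>" "sets \<nu> = sets (restrict_space borel unit_cube)"
  shows "wasserstein p N \<mu> \<nu> powr p \<le> norm_diameter N (semiopen_unit_cube :: (real ^ 'd) set) powr p *
    ((2 powr p + 1) / 2 * (\<Sum>l = 1..L. 2 powr (- p * real l) *
       (\<Sum>F\<in>dyadic_partition' l. \<bar>measure \<mu> F - measure \<nu> F\<bar>))
     + 2 powr (- p * real L))"
proof -
  let ?D = "norm_diameter N (semiopen_unit_cube :: (real ^ 'd) set)"
  define \<Delta> where "\<Delta> l = (\<Sum>F\<in>dyadic_partition' l. \<bar>measure \<mu> F - measure \<nu> F\<bar>)" for l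
  have space: "space \<mu> = unit_cube" "space \<nu> = unit_cube"
    using sets_eq_imp_space_eq[OF \<mu>(2)] sets_eq_imp_space_eq[OF \<nu>(2)]
    by (simp_all add: space_restrict_space)
  have "0 \<le> N 0" using N by (auto simp: is_norm_def)
  also have "N 0 \<le> ?D"
    using norm_unit_cube_le_diameter[OF N, of 0 0] by (simp add: unit_cube_def)
  finally have D: "0 \<le> ?D" .
  have sum_eq: "(\<Sum>k\<in>cell_indices l. \<bar>measure \<mu> {x \<in> space \<mu>. cell_index l x = k} -
      measure \<nu> {x \<in> space \<nu>. cell_index l x = k}\<bar>) = \<Delta> l" for l
    unfolding \<Delta>_def sum_dyadic_partition'
    by (intro sum.cong refl) (simp add: space fibre_cell_index)
  have "wasserstein p N \<mu> \<nu> powr p \<le> ?D powr p *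
    ((2 powr p - 1) / 2 * (\<Sum>l = 1..L. 2 powr (- p * real l) *
      (\<Sum>k\<in>cell_indices l. \<bar>measure \<mu> {x \<in> space \<mu>. cell_index l x = k} -
        measure \<nu> {x \<in> space \<nu>. cell_index l x = k}\<bar>)) + 2 powr (- p * real L))"
  proof (rule wasserstein_multilevel[where \<kappa> = cell_index and J = cell_indices, OF _ \<mu>(1) \<nu>(1) _ finite_cell_indices cell_indices_0
        measurable_cell_index[OF \<mu>(2)]])
    show "p > 0" using \<open>p \<ge> 1\<close> by simp
    show "sets \<nu> = sets \<mu>" using \<mu> \<nu> by simp
    show "cell_index l x = cell_index l y" if "cell_index (Suc l) x = cell_index (Suc l) y"
      for l and x y :: "real ^ 'd"
      using that by (simp add: fun_eq_iff cell_index_Suc[of l])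
    show "(\<lambda>z. N (fst z - snd z)) \<in> borel_measurable (\<mu> \<Otimes>\<^sub>M \<nu>)"
      using N \<mu>(2) \<nu>(2) by (rule norm_measurable_unit_cube)
    show "0 \<le> N x" for x using N by (simp add: is_norm_def)
    show "0 \<le> ?D" by (rule D)
    show "N (x - y) \<le> ?D / 2 ^ l"
      if "x \<in> space \<mu>" "y \<in> space \<mu>" "cell_index l x = cell_index l y" for l x y
      using that unfolding space by (rule norm_same_cell_le[OF N])
  qed
  \<comment> \<open>Here 2^p - 1 is enlarged to the claimed 2^p + 1, all terms being
    nonnegative.\<close>
  also have "\<dots> \<le> ?D powr p * ((2 powr p + 1) / 2 * (\<Sum>l = 1..L. 2 powr (- p * real l) * \<Delta> l)
      + 2 powr (- p * real L))"
    unfolding sum_eq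
    by (intro mult_left_mono add_right_mono mult_right_mono sum_nonneg mult_nonneg_nonneg)
      (auto simp: \<Delta>_def intro!: sum_nonneg)
  finally show ?thesis by (simp add: \<Delta>_def)
qed

section \<open>Passage to infinitely many levels\<close>

lemma sum_measure_dyadic_partition'_le:
  fixes \<mu> \<nu> :: "(real ^ 'd) measure"
  assumes \<mu>: "prob_space \<mu>" "sets \<mu> = sets (restrict_space borel unit_cube)"
    and \<nu>: "prob_space \<nu>" "sets \<nu> = sets (restrict_space borel unit_cube)"
  shows "(\<Sum>F\<in>dyadic_partition' l. \<bar>measure \<mu> F - measure \<nu> F\<bar>) \<le> 2"
proof -
  have one: "(\<Sum>F\<in>dyadic_partition' l. measure M F) = 1"
    if "prob_space M" "sets M = sets (restrict_space borel unit_cube)" for M :: "(real ^ 'd) measure"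
  proof -
    interpret prob_space M by fact
    have "space M = unit_cube"
      using sets_eq_imp_space_eq[OF that(2)] by (simp add: space_restrict_space)
    then have "(\<Sum>F\<in>dyadic_partition' l. measure M F) =
        (\<Sum>k\<in>cell_indices l. measure M {x \<in> space M. cell_index l x = k})"
      unfolding sum_dyadic_partition' by (intro sum.cong refl) (simp add: fibre_cell_index)
    also have "\<dots> = 1"
      using measure_fibres[OF finite_cell_indices measurable_cell_index[OF that(2)], of "\<lambda>_. True"]
      by (simp add: prob_space)
    finally show ?thesis .
  qed
  have "(\<Sum>F\<in>dyadic_partition' l. \<bar>measure \<mu> F - measure \<nu> F\<bar>) \<le>
      (\<Sum>F\<in>dyadic_partition' l. measure \<mu> F + measure \<nu> F)"
    by (intro sum_mono) (simp add: abs_le_iff add_increasing)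
  also have "\<dots> = 2"
    using one[OF \<mu>] one[OF \<nu>] by (simp add: sum.distrib)
  finally show ?thesis .
qed

text \<open>\<open>infsum\<close> is 0 by default on a family that is not summable, so summability
  has to be secured before the series can bound anything. It is applied with \<open>B = 2\<close>,
  the bound for the level differences.\<close>

lemma summable_on_geometric_bounded:
  fixes p B :: real and g :: "nat \<Rightarrow> real"
  assumes "p > 0" and "\<And>l. 0 \<le> g l" and "\<And>l. g l \<le> B"
  shows "(\<lambda>l. 2 powr (- p * real l) * g l) summable_on A"
proof -
  have geometric: "summable (\<lambda>l. B * (2 powr (- p)) ^ l)"
    using \<open>p > 0\<close> by (intro summable_mult summable_geometric) (simp add: powr_less_one)
  have le: "norm (2 powr (- p * real l) * g l) \<le> B * (2 powr (- p)) ^ l" for l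
  proof -
    have "(2 powr (- p)) ^ l = 2 powr (- p * real l)"
      by (simp add: powr_realpow[symmetric] powr_powr)
    then show ?thesis using assms(2)[of l] assms(3)[of l] by (simp add: abs_mult mult.commute)
  qed
  have "summable (\<lambda>l. norm (2 powr (- p * real l) * g l))"
    by (rule summable_norm_comparison_test[OF _ geometric]) (use le in blast)
  then have "(\<lambda>l. 2 powr (- p * real l) * g l) summable_on UNIV"
    by (rule norm_summable_imp_summable_on)
  then show ?thesis by (rule summable_on_subset_banach) simp
qed

text \<open>Partial sums of nonnegative terms stay below the series; once they are replaced by it,
  only the remainder depends on \<open>L\<close>, and it tends to 0.\<close>

lemma wasserstein_dyadic_infinite:
  fixes N :: "real ^ 'd \<Rightarrow> real" and \<mu> \<nu> :: "(real ^ 'd) measure" and p :: real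
  assumes "p \<ge> 1" and N: "is_norm N"
    and \<mu>: "prob_space \<mu>" "sets \<mu> = sets (restrict_space borel unit_cube)"
    and \<nu>: "prob_space \<nu>" "sets \<nu> = sets (restrict_space borel unit_cube)"
  shows "wasserstein p N \<mu> \<nu> powr p
    \<le> norm_diameter N (semiopen_unit_cube :: (real ^ 'd) set) powr p * ((2 powr p + 1) / 2) *
       (\<Sum>\<^sub>\<infinity>l\<in>{1..}. 2 powr (- p * real l) *
          (\<Sum>F\<in>dyadic_partition' l. \<bar>measure \<mu> F - measure \<nu> F\<bar>))"
proof -
  define D where "D = norm_diameter N (semiopen_unit_cube :: (real ^ 'd) set) powr p"
  define C where "C = (2 powr p + 1) / 2"
  define \<Delta> where "\<Delta> l = (\<Sum>F\<in>dyadic_partition' l. \<bar>measure \<mu> F - measure \<nu> F\<bar>)" for l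
  define S where "S = (\<Sum>\<^sub>\<infinity>l\<in>{1..}. 2 powr (- p * real l) * \<Delta> l)"
  have \<Delta>0: "0 \<le> \<Delta> l" for l by (auto simp: \<Delta>_def intro: sum_nonneg)
  have summ: "(\<lambda>l. 2 powr (- p * real l) * \<Delta> l) summable_on {1..}"
    using \<open>p \<ge> 1\<close> \<Delta>0 sum_measure_dyadic_partition'_le[OF \<mu> \<nu>, folded \<Delta>_def]
    by (intro summable_on_geometric_bounded[where B = 2]) auto
  have "wasserstein p N \<mu> \<nu> powr p \<le> D * (C * S + 2 powr (- p * real L))" for L
  proof -
    have le_S: "(\<Sum>l = 1..L. 2 powr (- p * real l) * \<Delta> l) \<le> S"
      unfolding S_def by (rule finite_sum_le_infsum[OF summ]) (auto simp: \<Delta>0)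
    have "wasserstein p N \<mu> \<nu> powr p \<le>
        D * (C * (\<Sum>l = 1..L. 2 powr (- p * real l) * \<Delta> l) + 2 powr (- p * real L))"
      unfolding D_def C_def \<Delta>_def by (rule wasserstein_dyadic_finite[OF assms])
    also have "\<dots> \<le> D * (C * S + 2 powr (- p * real L))"
      using le_S by (intro mult_left_mono add_right_mono) (simp_all add: D_def C_def)
    finally show ?thesis .
  qed
  moreover have "(\<lambda>L. D * (C * S + 2 powr (- p * real L))) \<longlonglongrightarrow> D * (C * S + 0)"
  proof -
    have "(\<lambda>L. 2 powr (- p * real L)) \<longlonglongrightarrow> 0"
    proof -
      have "(\<lambda>L. (2 powr (- p)) ^ L) \<longlonglongrightarrow> 0"
        using \<open>p \<ge> 1\<close> by (intro LIMSEQ_realpow_zero) (simp_all add: powr_less_one)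
      then show ?thesis by (simp add: powr_realpow[symmetric] powr_powr)
    qed
    then show ?thesis by (intro tendsto_intros)
  qed
  ultimately have "wasserstein p N \<mu> \<nu> powr p \<le> D * (C * S + 0)"
    by (intro LIMSEQ_le_const) auto
  then show ?thesis by (simp add: D_def C_def S_def \<Delta>_def mult.assoc)
qed

lemma sum_dyadic_partition_eq:
  fixes \<mu> \<nu> :: "(real ^ 'd) measure"
  assumes \<mu>: "prob_space \<mu>" "sets \<mu> = sets (restrict_space borel unit_cube)" "measure \<mu> semiopen_unit_cube = 1"
    and \<nu>: "prob_space \<nu>" "sets \<nu> = sets (restrict_space borel unit_cube)" "measure \<nu> semiopen_unit_cube = 1"
  shows "(\<Sum>F\<in>dyadic_partition l. \<bar>measure \<mu> F - measure \<nu> F\<bar>) =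
    (\<Sum>F\<in>dyadic_partition' l. \<bar>measure \<mu> F - measure \<nu> F\<bar>)"
proof -
  have "\<bar>measure \<mu> (dyadic_cube l k) - measure \<nu> (dyadic_cube l k)\<bar> =
      \<bar>measure \<mu> (dyadic_cube' l k) - measure \<nu> (dyadic_cube' l k)\<bar>" if "k \<in> cell_indices l" for k
    unfolding measure_dyadic_cube_eq[OF \<mu> that] measure_dyadic_cube_eq[OF \<nu> that] ..
  then show ?thesis
    by (subst sum_dyadic_partition, subst sum_dyadic_partition') (rule sum.cong[OF refl])
qed

theorem proposition2p2:
  fixes p :: real
    and N :: "real ^ 'd \<Rightarrow> real"
    and \<mu> \<nu> :: "(real ^ 'd) measure"
  assumes "p \<ge> 1"
    and "is_norm N"
    and "prob_space \<mu>" and "sets \<mu> = sets (restrict_space borel unit_cube)"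
    and "prob_space \<nu>" and "sets \<nu> = sets (restrict_space borel unit_cube)"
  shows
    "(measure \<mu> semiopen_unit_cube = 1 \<and> measure \<nu> semiopen_unit_cube = 1 \<longrightarrow>
        wasserstein p N \<mu> \<nu> powr p
          \<le> norm_diameter N (semiopen_unit_cube :: (real ^ 'd) set) powr p * ((2 powr p + 1) / 2) *
             (\<Sum>\<^sub>\<infinity>l\<in>{1..}. 2 powr (- p * real l) *
                (\<Sum>F\<in>dyadic_partition l. \<bar>measure \<mu> F - measure \<nu> F\<bar>)) \<and>
        (\<forall>l0\<ge>1.
          wasserstein p N \<mu> \<nu> powr p
            \<le> norm_diameter N (semiopen_unit_cube :: (real ^ 'd) set) powr p *
               ((2 powr p + 1) / 2 *
                  (\<Sum>l = 1..l0. 2 powr (- p * real l) *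
                     (\<Sum>F\<in>dyadic_partition l. \<bar>measure \<mu> F - measure \<nu> F\<bar>))
                + 2 powr (- p * real l0)))) \<and>
     wasserstein p N \<mu> \<nu> powr p
       \<le> norm_diameter N (semiopen_unit_cube :: (real ^ 'd) set) powr p * ((2 powr p + 1) / 2) *
          (\<Sum>\<^sub>\<infinity>l\<in>{1..}. 2 powr (- p * real l) *
             (\<Sum>F\<in>dyadic_partition' l. \<bar>measure \<mu> F - measure \<nu> F\<bar>))"
proof (intro conjI impI allI)
  note infinite = wasserstein_dyadic_infinite[OF assms] and finite = wasserstein_dyadic_finite[OF assms]
  show "wasserstein p N \<mu> \<nu> powr p
       \<le> norm_diameter N (semiopen_unit_cube :: (real ^ 'd) set) powr p * ((2 powr p + 1) / 2) *
          (\<Sum>\<^sub>\<infinity>l\<in>{1..}. 2 powr (- p * real l) *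
             (\<Sum>F\<in>dyadic_partition' l. \<bar>measure \<mu> F - measure \<nu> F\<bar>))"
    by (rule infinite)
  assume "measure \<mu> semiopen_unit_cube = 1 \<and> measure \<nu> semiopen_unit_cube = 1"
  then have sum_eq: "(\<Sum>F\<in>dyadic_partition l. \<bar>measure \<mu> F - measure \<nu> F\<bar>) =
      (\<Sum>F\<in>dyadic_partition' l. \<bar>measure \<mu> F - measure \<nu> F\<bar>)" for l
    by (intro sum_dyadic_partition_eq assms(3-6)) auto
  show "wasserstein p N \<mu> \<nu> powr p
       \<le> norm_diameter N (semiopen_unit_cube :: (real ^ 'd) set) powr p * ((2 powr p + 1) / 2) *
          (\<Sum>\<^sub>\<infinity>l\<in>{1..}. 2 powr (- p * real l) *
             (\<Sum>F\<in>dyadic_partition l. \<bar>measure \<mu> F - measure \<nu> F\<bar>))"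
    unfolding sum_eq by (rule infinite)
  fix l0 :: nat
  show "wasserstein p N \<mu> \<nu> powr p
            \<le> norm_diameter N (semiopen_unit_cube :: (real ^ 'd) set) powr p *
               ((2 powr p + 1) / 2 *
                  (\<Sum>l = 1..l0. 2 powr (- p * real l) *
                     (\<Sum>F\<in>dyadic_partition l. \<bar>measure \<mu> F - measure \<nu> F\<bar>))
                + 2 powr (- p * real l0))"
    unfolding sum_eq by (rule finite)
qed

end
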